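(* Let $d \ge 1$, and let $\omega \in \mathbb{R}^{2d\times 2d}$ be an anti-symmetric matrix and $R^{-1} \in \mathbb{R}^{2d\times 2d}$ a constant matrix with the block forms $$\omega = \begin{pmatrix} 0 & A\\ -A & 0\end{pmatrix}, \qquad R^{-1} = \begin{pmatrix} 0 & 0\\ 0 & B\end{pmatrix},$$ where $A \in \mathbb{R}^{d\times d}$ is positive-definite (and symmetric, as forced by the anti-symmetry of $\omega$) and $B\in\mathbb{R}^{d\times d}$ is a constant positive-definite symmetric matrix. Let $(X_s)_{s\ge0}$ be the solution in $\mathbb{R}^{2d}$ of $$dX_s = \frac12\big[-R^{-1}X_s - 2\omega X_s\big]ds + \sqrt{R^{-1}}\,dW_s ,$$ started from an arbitrary initial distribution (in particular, from an arbitrary deterministic point). Then the distribution $p_s$ of $X_s$ converges, as $s\to\infty$, to the standard Gaussian distribution $\mathcal{N}(0,I)$ on $\mathbb{R}^{2d}$.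
   Context: $W_s$ is a standard $2d$-dimensional Brownian motion. $\sqrt{R^{-1}}$ is the symmetric positive semi-definite square root of the (degenerate) positive semi-definite matrix $R^{-1}$; the notation $R^{-1}$ is kept although this matrix is not invertible. Convergence of $p_s$ is understood as convergence in distribution (weak convergence of probability measures). *)

theory Defs
  imports "HOL-Probability.Probability"
begin

definition block_matrix ::
  "'a^'m^'m \<Rightarrow> 'a^'n^'m \<Rightarrow> 'a^'m^'n \<Rightarrow> 'a^'n^'n \<Rightarrow> 'a^('m::finite + 'n::finite)^('m + 'n)" where
  "block_matrix A B C D = (\<chi> i j.
     case i of
       Inl k \<Rightarrow> (case j of Inl l \<Rightarrow> A $ k $ l | Inr l \<Rightarrow> B $ k $ l)
     | Inr k \<Rightarrow> (case j of Inl l \<Rightarrow> C $ k $ l | Inr l \<Rightarrow> D $ k $ l))"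

text \<open>Neither of the following two predicates includes symmetry.\<close>

definition pos_definite :: "real^'n^'n \<Rightarrow> bool" where
  "pos_definite M \<longleftrightarrow> (\<forall>x. x \<noteq> 0 \<longrightarrow> 0 < x \<bullet> (M *v x))"

definition pos_semidefinite :: "real^'n^'n \<Rightarrow> bool" where
  "pos_semidefinite M \<longleftrightarrow> (\<forall>x. 0 \<le> x \<bullet> (M *v x))"

text \<open>Meaningful for symmetric positive semi-definite \<open>M\<close>, where such a root exists uniquely.\<close>

definition matrix_sqrt :: "real^'n^'n \<Rightarrow> real^'n^'n" where
  "matrix_sqrt M = (THE S. transpose S = S \<and> pos_semidefinite S \<and> S ** S = M)"

text \<open>The centred Gaussian distribution with covariance \<open>v I\<close>, for \<open>v > 0\<close>.\<close>

definition isotropic_gaussian :: "real \<Rightarrow> 'a::euclidean_space measure" where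
  "isotropic_gaussian v = density lborel (\<lambda>x. ennreal
     ((2 * pi * v) powr (- real DIM('a) / 2) * exp (- (norm x)\<^sup>2 / (2 * v))))"

abbreviation standard_gaussian :: "'a::euclidean_space measure" where
  "standard_gaussian \<equiv> isotropic_gaussian 1"

text \<open>
  Time is \<open>[0,\<infinity>)\<close>, encoded by real indices; the values of processes at negative times are
  irrelevant, and a filtration on \<open>[0,\<infinity>)\<close> is extended to negative times by its value at \<open>0\<close>.
\<close>

definition prob_filtration :: "'s measure \<Rightarrow> (real \<Rightarrow> 's measure) \<Rightarrow> bool" where
  "prob_filtration M F \<longleftrightarrow> filtration (space M) F \<and> (\<forall>t. subalgebra M (F t))"

definition adapted_process ::
  "(real \<Rightarrow> 's measure) \<Rightarrow> (real \<Rightarrow> 's \<Rightarrow> 'a::euclidean_space) \<Rightarrow> bool" where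
  "adapted_process F X \<longleftrightarrow> (\<forall>t\<ge>0. X t \<in> borel_measurable (F t))"

definition brownian_motion ::
  "'s measure \<Rightarrow> (real \<Rightarrow> 's measure) \<Rightarrow> (real \<Rightarrow> 's \<Rightarrow> 'a::euclidean_space) \<Rightarrow> bool" where
  "brownian_motion M F W \<longleftrightarrow>
     adapted_process F W \<and>
     (AE x in M. W 0 x = 0) \<and>
     (AE x in M. continuous_on {0..} (\<lambda>t. W t x)) \<and>
     (\<forall>s t. 0 \<le> s \<longrightarrow> s < t \<longrightarrow>
        distr M borel (\<lambda>x. W t x - W s x) = isotropic_gaussian (t - s) \<and>
        prob_space.indep_set M (sets (F s))
          (sets (vimage_algebra (space M) (\<lambda>x. W t x - W s x) borel)))"

text \<open>
  Solutions of \<open>dX = b(X) dt + S dW\<close> with a constant diffusion matrix \<open>S\<close>, in integrated form.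
  As \<open>S\<close> is constant, the stochastic integral of \<open>S\<close> over \<open>[0,t]\<close> is \<open>S (W\<^sub>t - W\<^sub>0)\<close>.
  The initial value \<open>X\<^sub>0\<close> may be any random vector measurable at time \<open>0\<close>, hence independent
  of the Brownian increments.
\<close>

definition sde_solution ::
  "'s measure \<Rightarrow> (real \<Rightarrow> 's measure) \<Rightarrow> (real \<Rightarrow> 's \<Rightarrow> real^'n) \<Rightarrow>
   (real^'n \<Rightarrow> real^'n) \<Rightarrow> real^'n^'n \<Rightarrow> (real \<Rightarrow> 's \<Rightarrow> real^'n) \<Rightarrow> bool" where
  "sde_solution M F W b S X \<longleftrightarrow>
     adapted_process F X \<and>
     (AE x in M. continuous_on {0..} (\<lambda>t. X t x)) \<and>
     (AE x in M. \<forall>t\<ge>0.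
        X t x = X 0 x + integral {0..t} (\<lambda>s. b (X s x)) + S *v (W t x - W 0 x))"

text \<open>
  Convergence against bounded continuous functions: \<^const>\<open>weak_conv_m\<close> only covers sequences of
  measures on the real line.
\<close>

definition converges_weakly ::
  "('i \<Rightarrow> 'a::topological_space measure) \<Rightarrow> 'a measure \<Rightarrow> 'i filter \<Rightarrow> bool" where
  "converges_weakly p q G \<longleftrightarrow>
     (\<forall>f::'a \<Rightarrow> real. continuous_on UNIV f \<longrightarrow> bounded (range f) \<longrightarrow>
        ((\<lambda>i. \<integral>x. f x \<partial>p i) \<longlongrightarrow> (\<integral>x. f x \<partial>q)) G)"

end

theory Submission
  imports Defs
begin

text \<open>
  Write the equation as \<open>dX = C X dt + S dW\<close>, so that \<open>C + C\<^sup>T = - S S\<^sup>T\<close>. Along a solution of the dual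
  flow \<open>u' = C\<^sup>T u\<close>, \<open>u 0 = \<xi>\<close>, the process \<open>u (T - s) \<bullet> X s\<close> has no drift, and its accumulated variance
  is \<open>(norm \<xi>)\<^sup>2 - (norm (u T))\<^sup>2\<close>. Approximating by Riemann-Stieltjes sums over independent Brownian
  increments gives the characteristic function
  \<open>E exp (i \<xi> \<bullet> X T) = E exp (i u T \<bullet> X 0) exp (- ((norm \<xi>)\<^sup>2 - (norm (u T))\<^sup>2) / 2)\<close>. A hypocoercive
  Lyapunov function shows that \<open>u T\<close> tends to \<open>0\<close>, so the characteristic functions converge to the
  Gaussian one, and Levy's continuity theorem, itself obtained by Gaussian smoothing, concludes.
\<close>

subsection \<open>Square roots of positive semi-definite matrices\<close>

text \<open>The obstacle is that friction and noise both act through \<open>Rinv\<close>, which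
  vanishes on half of the coordinates. Along the dual flow the energy
  \<open>(norm (u t))\<^sup>2\<close> therefore only fails to increase: its derivative is zero
  whenever the second block of \<open>u t\<close> vanishes. The matrix \<open>\<omega>\<close>
  contributes nothing to this energy, being anti-symmetric, and this is why the limiting covariance
  is the identity whatever \<open>A\<close> and \<open>B\<close> are. Its role is to rotate the
  undamped block into the damped one, and definiteness of \<open>A\<close> makes that happen in
  every direction. Passing to the dual flow keeps all integrands deterministic and differentiable,
  so a pathwise limit of sums replaces the stochastic integral. The initial law enters only through
  a bounded integrand, so an initial value without moments is covered as well. The diffusion matrix
  is given by a definite description. Existence and uniqueness of the root have to be settled before
  anything is known about it; afterwards only its symmetry and its square matter.\<close>

lemma psd_form_null:
  fixes P :: "'a::real_inner \<Rightarrow> 'a"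
  assumes lin: "linear P" and V: "subspace V" and PV: "\<And>x. x \<in> V \<Longrightarrow> P x \<in> V"
    and sym: "\<And>x y. P x \<bullet> y = x \<bullet> P y"
    and psd: "\<And>x. x \<in> V \<Longrightarrow> 0 \<le> x \<bullet> P x"
    and e: "e \<in> V" "e \<bullet> P e = 0"
  shows "P e = 0"
proof (rule ccontr)
  assume "P e \<noteq> 0"
  \<comment> \<open>The form along \<open>e + t y\<close> is the parabola
    \<open>2 t n + t\<^sup>2 c\<close>, with value 0 and slope \<open>2 n > 0\<close> at 0, hence
    negative for small negative \<open>t\<close>. The \<open>+ 1\<close> in the chosen
    \<open>t\<close> keeps the quotient meaningful when \<open>c = 0\<close>.\<close>
  define y n c t where "y = P e" and "n = y \<bullet> y" and "c = y \<bullet> P y" and "t = - n / (c + 1)"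
  have yV: "y \<in> V" using PV e y_def by simp
  have n: "n > 0" using \<open>P e \<noteq> 0\<close> by (simp add: n_def y_def)
  have c: "c \<ge> 0" using psd[OF yV] by (simp add: c_def)
  have "e \<bullet> P y = n" by (metis sym y_def n_def)
  then have "(e + t *\<^sub>R y) \<bullet> P (e + t *\<^sub>R y) = 2 * t * n + t\<^sup>2 * c"
    using e(2)
    by (simp add: linear_add[OF lin] linear_scale[OF lin] inner_simps c_def flip: y_def)
      (simp add: n_def power2_eq_square algebra_simps)
  moreover have "0 \<le> (e + t *\<^sub>R y) \<bullet> P (e + t *\<^sub>R y)"
    by (intro psd subspace_add subspace_scale V e yV)
  moreover have "2 * t * n + t\<^sup>2 * c = - (t\<^sup>2 * (c + 2))"
  proof -
    have "n = - t * (c + 1)" using c by (simp add: t_def)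
    then show ?thesis by (simp only: power2_eq_square) (simp add: algebra_simps)
  qed
  moreover have "t \<noteq> 0" using n c by (simp add: t_def)
  then have "t\<^sup>2 * (c + 2) > 0" using c by simp
  ultimately show False by simp
qed

text \<open>A maximiser \<open>e\<close> of the Rayleigh quotient on the unit sphere of
  \<open>V\<close> works: with \<open>l\<close> the maximum, \<open>l I - f\<close> is positive
  semi-definite on \<open>V\<close> and its form vanishes at \<open>e\<close>, so it annihilates
  \<open>e\<close>.\<close>

lemma symmetric_eigenvector_on_subspace:
  fixes f :: "'a::euclidean_space \<Rightarrow> 'a"
  assumes lin: "linear f" and sym: "\<And>x y. f x \<bullet> y = x \<bullet> f y"
    and V: "subspace V" and fV: "\<And>x. x \<in> V \<Longrightarrow> f x \<in> V" and ne: "V \<noteq> {0}"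
  obtains e l where "e \<in> V" "norm e = 1" "f e = l *\<^sub>R e"
proof -
  let ?S = "V \<inter> sphere 0 1"
  have "compact ?S" using closed_subspace[OF V] by (simp add: closed_Int_compact)
  moreover obtain z where z: "z \<in> V" "z \<noteq> 0" using ne V subspace_0 by blast
  then have "z /\<^sub>R norm z \<in> ?S" using V by (simp add: subspace_scale)
  moreover have "continuous_on ?S (\<lambda>x. x \<bullet> f x)"
    by (intro continuous_intros linear_continuous_on) (use lin linear_conv_bounded_linear in blast)
  ultimately obtain e where e: "e \<in> ?S" and max: "\<And>x. x \<in> ?S \<Longrightarrow> x \<bullet> f x \<le> e \<bullet> f e"
    using continuous_attains_sup[of ?S "\<lambda>x. x \<bullet> f x"] by blast
  define l P where "l = e \<bullet> f e" and "P = (\<lambda>x. l *\<^sub>R x - f x)"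
  have "P e = 0"
  proof (rule psd_form_null[where P=P and V=V and e=e, OF _ V])
    show "linear P" unfolding P_def by (intro linearI) (simp_all add: linear_add[OF lin] linear_scale[OF lin] algebra_simps)
    show "P x \<in> V" if "x \<in> V" for x
      unfolding P_def by (intro subspace_diff subspace_scale V fV that)
    show "P x \<bullet> y = x \<bullet> P y" for x y by (simp add: P_def inner_simps sym)
    show "e \<in> V" using e by simp
    show "e \<bullet> P e = 0" using e by (simp add: P_def inner_simps l_def dot_square_norm)
    show "0 \<le> x \<bullet> P x" if "x \<in> V" for x
    proof (cases "x = 0")
      case False
      have "(x /\<^sub>R norm x) \<bullet> f (x /\<^sub>R norm x) \<le> l"
        unfolding l_def using that False V by (intro max) (simp add: subspace_scale)
      then have "x \<bullet> f x \<le> l * (norm x)\<^sup>2"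
        using False by (simp add: linear_scale[OF lin] field_simps power2_eq_square)
      then show ?thesis by (simp add: P_def inner_simps dot_square_norm)
    qed (simp add: P_def)
  qed
  then show ?thesis using e that[of e l] by (simp add: P_def)
qed

text \<open>The vectors of \<open>V\<close> orthogonal to an eigenvector form an invariant subspace
  of smaller dimension. The statement speaks of invariant subspaces because the type fixes the
  dimension of the whole space, so the induction has to run inside it.\<close>

lemma symmetric_eigenbasis_on_subspace:
  fixes f :: "'a::euclidean_space \<Rightarrow> 'a"
  assumes lin: "linear f" and sym: "\<And>x y. f x \<bullet> y = x \<bullet> f y"
  shows "subspace V \<Longrightarrow> (\<And>x. x \<in> V \<Longrightarrow> f x \<in> V) \<Longrightarrow>
    \<exists>E. finite E \<and> pairwise orthogonal E \<and> (\<forall>e\<in>E. norm e = 1 \<and> (\<exists>l. f e = l *\<^sub>R e)) \<and> span E = V"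
proof (induction "dim V" arbitrary: V rule: less_induct)
  case less
  show ?case
  proof (cases "V = {0}")
    case True
    then show ?thesis by (intro exI[of _ "{}"]) auto
  next
    case False
    obtain e l where e: "e \<in> V" "norm e = 1" "f e = l *\<^sub>R e"
      using symmetric_eigenvector_on_subspace[OF lin sym less.prems False] by metis
    define U where "U = {x \<in> V. x \<bullet> e = 0}"
    have U: "subspace U"
      using less.prems(1) by (auto simp: U_def subspace_def inner_simps)
    have fU: "f x \<in> U" if "x \<in> U" for x
      using that less.prems(2) by (simp add: U_def sym e(3))
    have "e \<notin> U" using e by (auto simp: U_def)
    then have "U \<subset> V" using e U_def by blast
    then have "span U \<subset> span V" using U less.prems(1) span_eq_iff by metis
    then have "dim U < dim V" by (rule dim_psubset)
    from less.hyps[OF this U fU] obtain E where E: "finite E" "pairwise orthogonal E"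
      "\<forall>e\<in>E. norm e = 1 \<and> (\<exists>l. f e = l *\<^sub>R e)" "span E = U" by blast
    have EU: "E \<subseteq> U" using E(4) span_superset by blast
    have "span (insert e E) = V"
    proof
      show "span (insert e E) \<subseteq> V"
        using EU e \<open>U \<subset> V\<close> by (intro span_minimal less.prems) auto
      show "V \<subseteq> span (insert e E)"
      proof
        fix x assume x: "x \<in> V"
        have "x - (x \<bullet> e) *\<^sub>R e \<in> span E"
          using x e less.prems(1)
          by (simp add: E(4) U_def inner_simps dot_square_norm subspace_diff subspace_scale)
        then show "x \<in> span (insert e E)" using span_breakdown_eq by blast
      qed
    qed
    moreover have "pairwise orthogonal (insert e E)"
      using E(2) EU by (auto simp: pairwise_insert orthogonal_def U_def inner_commute)
    ultimately show ?thesis using E e by (intro exI[of _ "insert e E"]) auto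
  qed
qed

lemma inner_symmetric_matrix:
  fixes S :: "real^'n^'n"
  assumes "transpose S = S"
  shows "(S *v x) \<bullet> y = x \<bullet> (S *v y)"
  using dot_lmul_matrix[of x S y] vector_transpose_matrix[of x S] assms
  by (metis transpose_matrix_vector)

lemma symmetric_matrix_of_inner:
  fixes S :: "real^'n^'n"
  assumes "\<And>x y. (S *v x) \<bullet> y = x \<bullet> (S *v y)"
  shows "transpose S = S"
proof -
  have "(transpose S *v x) \<bullet> y = (S *v x) \<bullet> y" for x y
    by (metis assms dot_lmul_matrix transpose_matrix_vector inner_commute)
  then have "transpose S *v x = S *v x" for x
    by (metis vector_eq_rdot)
  then show ?thesis by (simp add: matrix_eq)
qed

lemma matrix_sqrt_exists:
  fixes M :: "real^'n^'n"
  assumes sym: "transpose M = M" and psd: "pos_semidefinite M"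
  shows "\<exists>S. transpose S = S \<and> pos_semidefinite S \<and> S ** S = M"
proof -
  obtain E where E: "finite E" "pairwise orthogonal E" "span E = UNIV"
    and eig: "\<forall>e\<in>E. norm e = 1 \<and> (\<exists>l. M *v e = l *\<^sub>R e)"
    using symmetric_eigenbasis_on_subspace[of "(*v) M" UNIV] inner_symmetric_matrix[OF sym]
    by auto
  from eig obtain l where n1: "\<And>e. e \<in> E \<Longrightarrow> norm e = 1" and l: "\<And>e. e \<in> E \<Longrightarrow> M *v e = l e *\<^sub>R e"
    by metis
  have l0: "l e \<ge> 0" if "e \<in> E" for e
    using psd l[OF that] n1[OF that] 
    by (metis inner_scaleR_right mult.right_neutral norm_eq_1 pos_semidefinite_def)
  have exp: "(\<Sum>e\<in>E. (x \<bullet> e) *\<^sub>R e) = x" for x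
    by (rule orthonormal_basis_expand) (use E n1 in auto)
  \<comment> \<open>The root has the same eigenvectors, with each eigenvalue replaced by its square
    root; \<open>l0\<close> makes this legitimate.\<close>
  define g where "g = (\<lambda>x. \<Sum>e\<in>E. (sqrt (l e) * (x \<bullet> e)) *\<^sub>R e)"
  have lin: "linear g"
    unfolding g_def by (intro linearI) (simp_all add: inner_simps algebra_simps sum.distrib scaleR_sum_right)
  define S where "S = matrix g"
  have S: "S *v x = g x" for x unfolding S_def using matrix_vector_mul(2)[OF lin] by metis
  have ginner: "g x \<bullet> y = (\<Sum>e\<in>E. sqrt (l e) * (x \<bullet> e) * (y \<bullet> e))" for x y
    by (simp add: g_def inner_sum_right inner_commute[of _ y])
  have "transpose S = S"
  proof (rule symmetric_matrix_of_inner)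
    show "(S *v x) \<bullet> y = x \<bullet> (S *v y)" for x y
      unfolding S inner_commute[of x "g y"] ginner by (simp only: mult.assoc mult.commute[of "x \<bullet> _"])
  qed
  moreover have "pos_semidefinite S"
    unfolding pos_semidefinite_def S
  proof
    show "0 \<le> x \<bullet> g x" for x
      unfolding inner_commute[of x "g x"] ginner
      by (intro sum_nonneg) (simp add: mult.assoc l0)
  qed
  moreover have "S ** S = M"
  proof -
    have ge: "g e = sqrt (l e) *\<^sub>R e" if "e \<in> E" for e
    proof -
      have "g e = (\<Sum>e'\<in>E. if e' = e then sqrt (l e) *\<^sub>R e else 0)"
        unfolding g_def
      proof (rule sum.cong)
        fix e' assume "e' \<in> E"
        then show "(sqrt (l e') * (e \<bullet> e')) *\<^sub>R e' = (if e' = e then sqrt (l e) *\<^sub>R e else 0)"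
          using E(2) n1[OF that] that
          by (auto simp: dot_square_norm pairwise_def orthogonal_def)
      qed simp
      then show ?thesis using E(1) that by simp
    qed
    have "g (g x) = M *v x" for x
    proof -
      have "g (g x) = (\<Sum>e\<in>E. (sqrt (l e) * (x \<bullet> e)) *\<^sub>R g e)"
        using arg_cong[OF g_def[THEN fun_cong, of x], of g]
        by (simp add: linear_sum[OF lin] linear_scale[OF lin])
      also have "\<dots> = (\<Sum>e\<in>E. (x \<bullet> e) *\<^sub>R (M *v e))"
        by (intro sum.cong) (auto simp: ge l l0)
      also have "\<dots> = M *v (\<Sum>e\<in>E. (x \<bullet> e) *\<^sub>R e)"
        by (simp add: linear_sum linear_scale)
      finally show ?thesis by (simp add: exp)
    qed
    then show ?thesis by (simp add: matrix_eq S flip: matrix_vector_mul_assoc)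
  qed
  ultimately show ?thesis by blast
qed

lemma trace_inner_axis: "trace (M :: real^'n^'n) = (\<Sum>i\<in>UNIV. axis i 1 \<bullet> (M *v axis i 1))"
  by (simp add: trace_def inner_axis' matrix_vector_mul_component inner_axis row_def)

lemma matrix_zero_of_axis:
  fixes M :: "real^'n^'n"
  assumes "\<And>i. M *v axis i 1 = 0"
  shows "M = 0"
  using assms by (metis column_def matrix_vector_mult_basis vec_eq_iff zero_index vec_lambda_beta)

text \<open>
  With \<open>D = S - T\<close> one has \<open>S D + D T = 0\<close>, so \<open>D S D\<close> and \<open>D T D\<close> are positive semi-definite
  matrices whose traces add up to \<open>0\<close>; hence \<open>S D = T D = 0\<close> and \<open>D\<^sup>2 = 0\<close>.
\<close>
lemma matrix_sqrt_unique:
  fixes S T :: "real^'n^'n"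
  assumes S: "transpose S = S" "pos_semidefinite S" and T: "transpose T = T" "pos_semidefinite T"
    and eq: "S ** S = T ** T"
  shows "S = T"
proof -
  define D where "D = S - T"
  have Dsym: "(D *v x) \<bullet> y = x \<bullet> (D *v y)" for x y
    by (simp add: D_def matrix_vector_mult_diff_rdistrib inner_simps inner_symmetric_matrix S T)
  have Dv: "D *v x = S *v x - T *v x" for x
    by (simp add: D_def matrix_vector_mult_diff_rdistrib)
  have "(S ** D + D ** T) *v x = 0" for x
  proof -
    have "S *v (S *v x) = T *v (T *v x)" using eq by (simp add: matrix_vector_mul_assoc)
    then show ?thesis
      unfolding matrix_vector_mult_add_rdistrib matrix_vector_mul_assoc[symmetric] Dv
        matrix_vector_mult_diff_distrib by simp
  qed
  then have "S ** D + D ** T = 0" by (simp add: matrix_eq)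
  then have "D ** (S ** D) + D ** (D ** T) = 0"
    unfolding matrix_add_ldistrib[symmetric] by (simp only: times0_right)
  then have "trace (D ** (S ** D)) + trace (D ** (D ** T)) = 0"
    unfolding trace_add[symmetric] by (simp only:) (simp add: trace_def)
  moreover have "trace (D ** (D ** T)) = trace (D ** (T ** D))"
    by (metis matrix_mul_assoc trace_mul_sym)
  ultimately have tr: "trace (D ** (S ** D)) + trace (D ** (T ** D)) = 0" by simp
  have trc: "trace (D ** (P ** D)) = (\<Sum>i\<in>UNIV. (D *v axis i 1) \<bullet> (P *v (D *v axis i 1)))" for P
    unfolding trace_inner_axis by (simp add: Dsym flip: matrix_vector_mul_assoc)
  have nn: "0 \<le> (D *v axis i 1) \<bullet> (P *v (D *v axis i 1))" if "P = S \<or> P = T" for P i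
    using S T that by (auto simp: pos_semidefinite_def)
  have "P ** D = 0" if P: "P = S \<or> P = T" for P
  proof (rule matrix_zero_of_axis)
    fix i
    have "trace (D ** (S ** D)) \<ge> 0" "trace (D ** (T ** D)) \<ge> 0"
      unfolding trc by (intro sum_nonneg nn; simp)+
    then have "trace (D ** (P ** D)) = 0" using tr P by auto
    then have *: "(D *v axis i 1) \<bullet> (P *v (D *v axis i 1)) = 0"
      unfolding trc using nn[OF P] by (subst (asm) sum_nonneg_eq_0_iff) auto
    have "P *v (D *v axis i 1) = 0"
      by (rule psd_form_null[of "(*v) P" UNIV])
        (use P S T * in \<open>auto simp: pos_semidefinite_def inner_symmetric_matrix\<close>)
    then show "(P ** D) *v axis i 1 = 0" by (simp flip: matrix_vector_mul_assoc)
  qed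
  then have "S ** D = 0" "T ** D = 0" by simp_all
  then have "(D ** D) *v x = 0" for x
    using Dv[of "D *v x"] by (simp add: matrix_vector_mul_assoc)
  then have "D ** D = 0" by (simp add: matrix_eq)
  have "D *v x = 0" for x
  proof -
    have "(D *v x) \<bullet> (D *v x) = x \<bullet> ((D ** D) *v x)"
      by (simp add: Dsym flip: matrix_vector_mul_assoc)
    then show ?thesis using \<open>D ** D = 0\<close> by simp
  qed
  then have "D = 0" by (simp add: matrix_eq)
  then show ?thesis by (simp add: D_def)
qed

lemma matrix_sqrt:
  fixes M :: "real^'n^'n"
  assumes "transpose M = M" "pos_semidefinite M"
  shows "transpose (matrix_sqrt M) = matrix_sqrt M" "matrix_sqrt M ** matrix_sqrt M = M"
proof -
  have "\<exists>!S. transpose S = S \<and> pos_semidefinite S \<and> S ** S = M"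
    using matrix_sqrt_exists[OF assms] matrix_sqrt_unique by metis
  from theI'[OF this] show "transpose (matrix_sqrt M) = matrix_sqrt M" "matrix_sqrt M ** matrix_sqrt M = M"
    by (auto simp: matrix_sqrt_def)
qed

subsection \<open>Linear flows and decay of damped rotations\<close>

text \<open>The solution is the exponential series of \<open>t L\<close> applied to
  \<open>\<xi>\<close>. It is differentiated coordinate by coordinate, where it is an everywhere
  convergent real power series; the coefficient shift in \<open>diffs\<close> turns
  \<open>p n\<close> into \<open>p (Suc n) = L (p n)\<close>.\<close>

lemma linear_flow_exists:
  fixes L :: "'a::euclidean_space \<Rightarrow> 'a" and \<xi> :: 'a
  assumes "linear L"
  obtains u where "u 0 = \<xi>" "\<And>t. (u has_vector_derivative L (u t)) (at t)"
proof -
  have bl: "bounded_linear L" using assms by (simp add: linear_conv_bounded_linear)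
  then obtain K where K: "K > 0" "\<And>x. norm (L x) \<le> norm x * K"
    by (metis bounded_linear.pos_bounded)
  define p where "p n = (L ^^ n) \<xi>" for n
  have pSuc: "p (Suc n) = L (p n)" for n by (simp add: p_def)
  have pn: "norm (p n) \<le> norm \<xi> * K ^ n" for n
  proof (induction n)
    case (Suc n)
    have "norm (p (Suc n)) \<le> norm (p n) * K" using K(2) by (simp add: pSuc)
    also have "\<dots> \<le> norm \<xi> * K ^ n * K" using Suc K(1) by (intro mult_right_mono) auto
    finally show ?case by (simp add: mult_ac)
  qed (simp add: p_def)
  define a where "a t n = (t ^ n / fact n) *\<^sub>R p n" for t :: real and n
  have sm: "summable (a t)" for t
  proof (rule summable_norm_cancel, rule summable_comparison_test')
    have "summable (\<lambda>n. norm \<xi> * (inverse (fact n) * (K * \<bar>t\<bar>) ^ n))"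
      by (intro summable_mult summable_exp)
    then show "summable (\<lambda>n. norm \<xi> * (K * \<bar>t\<bar>) ^ n / fact n)"
      by (simp add: field_simps)
    show "norm (norm (a t n)) \<le> norm \<xi> * (K * \<bar>t\<bar>) ^ n / fact n" for n
      using mult_left_mono[OF pn[of n], of "\<bar>t\<bar> ^ n"]
      by (simp add: a_def power_abs divide_right_mono power_mult_distrib mult_ac)
  qed
  define u where "u t = suminf (a t)" for t
  have ub: "u t \<bullet> b = (\<Sum>n. (p n \<bullet> b / fact n) * t ^ n)" for t b
    unfolding u_def bounded_linear.suminf[OF bounded_linear_inner_left sm] by (simp add: a_def mult_ac)
  have Lub: "L (u t) \<bullet> b = (\<Sum>n. (L (p n) \<bullet> b / fact n) * t ^ n)" for t b
  proof -
    have "L (u t) = (\<Sum>n. L (a t n))" unfolding u_def by (rule bounded_linear.suminf[OF bl sm])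
    moreover have "summable (\<lambda>n. L (a t n))" by (rule bounded_linear.summable[OF bl sm])
    ultimately have "L (u t) \<bullet> b = (\<Sum>n. L (a t n) \<bullet> b)"
      using bounded_linear.suminf[OF bounded_linear_inner_left] by metis
    then show ?thesis by (simp add: a_def linear_scale[OF assms] mult_ac)
  qed
  have "((\<lambda>t. u t \<bullet> b) has_real_derivative L (u t) \<bullet> b) (at t)" for b t
  proof -
    let ?c = "\<lambda>n. p n \<bullet> b / fact n"
    have "summable (\<lambda>n. ?c n * t ^ n)" for t
      using bounded_linear.summable[OF bounded_linear_inner_left sm, of t b] by (simp add: a_def mult_ac)
    then have "((\<lambda>t. \<Sum>n. ?c n * t ^ n) has_real_derivative (\<Sum>n. diffs ?c n * t ^ n)) (at t)"
      by (rule termdiffs_strong_converges_everywhere)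
    moreover have "diffs ?c = (\<lambda>n. L (p n) \<bullet> b / fact n)"
      by (rule ext) (simp add: diffs_def pSuc divide_simps del: of_nat_Suc)
    ultimately show ?thesis by (simp add: ub Lub)
  qed
  then have "((\<lambda>t. \<Sum>b\<in>Basis. (u t \<bullet> b) *\<^sub>R b) has_vector_derivative (\<Sum>b\<in>Basis. (L (u t) \<bullet> b) *\<^sub>R b)) (at t)" for t
    by (auto intro!: derivative_eq_intros simp: has_real_derivative_iff_has_vector_derivative)
  then have "(u has_vector_derivative L (u t)) (at t)" for t
    by (simp add: euclidean_representation)
  moreover have "u 0 = \<xi>"
  proof (rule euclidean_eqI)
    fix b :: 'a
    show "u 0 \<bullet> b = \<xi> \<bullet> b" unfolding ub powser_zero by (simp add: p_def)
  qed
  ultimately show ?thesis using that by blast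
qed

section \<open>Block coordinates and the decay of the damped rotation\<close>

definition vec_left :: "'a^('m + 'n::finite) \<Rightarrow> 'a^('m::finite)" where
  "vec_left x = (\<chi> i. x $ Inl i)"

definition vec_right :: "'a^('m::finite + 'n) \<Rightarrow> 'a^('n::finite)" where
  "vec_right x = (\<chi> i. x $ Inr i)"

lemma sum_UNIV_Plus: "(\<Sum>i\<in>(UNIV :: ('m::finite + 'n::finite) set). f i) = (\<Sum>i\<in>UNIV. f (Inl i)) + (\<Sum>i\<in>UNIV. f (Inr i))"
  unfolding UNIV_Plus_UNIV[symmetric] by (subst sum.Plus) auto

lemma inner_left_right:
  fixes x y :: "real^('m::finite + 'n::finite)"
  shows "x \<bullet> y = vec_left x \<bullet> vec_left y + vec_right x \<bullet> vec_right y"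
  by (simp add: inner_vec_def sum_UNIV_Plus vec_left_def vec_right_def)

lemma linear_vec_left: "linear (vec_left :: real^('m::finite + 'n::finite) \<Rightarrow> _)"
  by (intro linearI) (simp_all add: vec_left_def vec_eq_iff)

lemma linear_vec_right: "linear (vec_right :: real^('m::finite + 'n::finite) \<Rightarrow> _)"
  by (intro linearI) (simp_all add: vec_right_def vec_eq_iff)

lemma block_matrix_mult:
  fixes x :: "real^('m::finite + 'n::finite)"
  shows "vec_left (block_matrix P Q R S *v x) = P *v vec_left x + Q *v vec_right x"
    and "vec_right (block_matrix P Q R S *v x) = R *v vec_left x + S *v vec_right x"
  by (simp_all add: vec_eq_iff vec_left_def vec_right_def block_matrix_def matrix_vector_mult_def sum_UNIV_Plus)

lemma pos_definite_lower_bound: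
  fixes M :: "real^'n^'n"
  assumes "pos_definite M"
  obtains m where "m > 0" "\<And>x. m * (norm x)\<^sup>2 \<le> x \<bullet> (M *v x)"
proof -
  let ?S = "sphere (0 :: real^'n) 1"
  have "?S \<noteq> {}" by simp
  moreover have "continuous_on ?S (\<lambda>x. x \<bullet> (M *v x))" by (intro continuous_intros)
  ultimately obtain e where e: "e \<in> ?S" and min: "\<And>x. x \<in> ?S \<Longrightarrow> e \<bullet> (M *v e) \<le> x \<bullet> (M *v x)"
    using continuous_attains_inf[of ?S "\<lambda>x. x \<bullet> (M *v x)"] by auto
  have "e \<noteq> 0" using e by auto
  then have "e \<bullet> (M *v e) > 0" using assms by (simp add: pos_definite_def)
  moreover have "e \<bullet> (M *v e) * (norm x)\<^sup>2 \<le> x \<bullet> (M *v x)" for x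
  proof (cases "x = 0")
    case False
    then have "e \<bullet> (M *v e) \<le> (x /\<^sub>R norm x) \<bullet> (M *v (x /\<^sub>R norm x))" by (intro min) simp
    then show ?thesis using False by (simp add: matrix_vector_mult_scaleR field_simps power2_eq_square)
  qed simp
  ultimately show ?thesis using that by blast
qed

text \<open>
  The dissipation only acts on the second block; the cross term \<open>2 \<epsilon> q \<bullet> p\<close> in the Lyapunov function
  transfers it to the first one, because the rotation contributes \<open>- 2 \<epsilon> q \<bullet> A q\<close> to its derivative.
\<close>
lemma damped_rotation_decay:
  fixes A B :: "real^'d^'d" and q p :: "real \<Rightarrow> real^'d"
  assumes symA: "\<And>x y. (A *v x) \<bullet> y = x \<bullet> (A *v y)" and A: "pos_definite A" and B: "pos_definite B"
    and q: "\<And>t. (q has_vector_derivative A *v p t) (at t)"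
    and p: "\<And>t. (p has_vector_derivative - (A *v q t) - (1/2) *\<^sub>R (B *v p t)) (at t)"
  shows "((\<lambda>t. (norm (q t))\<^sup>2 + (norm (p t))\<^sup>2) \<longlongrightarrow> 0) at_top"
proof -
  obtain a where a: "a > 0" "\<And>x. a * (norm x)\<^sup>2 \<le> x \<bullet> (A *v x)" using pos_definite_lower_bound[OF A] by blast
  obtain b where b: "b > 0" "\<And>x. b * (norm x)\<^sup>2 \<le> x \<bullet> (B *v x)" using pos_definite_lower_bound[OF B] by blast
  obtain \<alpha> where \<alpha>: "\<alpha> > 0" "\<And>x. norm (A *v x) \<le> norm x * \<alpha>"
    using bounded_linear.pos_bounded[OF matrix_vector_mul_bounded_linear[of A]] by blast
  obtain \<beta> where \<beta>: "\<beta> > 0" "\<And>x. norm (B *v x) \<le> norm x * \<beta>"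
    using bounded_linear.pos_bounded[OF matrix_vector_mul_bounded_linear[of B]] by blast
  \<comment> \<open>\<open>\<epsilon> C\<close> is the price in \<open>(norm (p t))\<^sup>2\<close>
    of the cross term: \<open>2 \<alpha>\<close> bounds the rotation part
    \<open>2 (p \<bullet> A p)\<close>, and \<open>\<beta>\<^sup>2 / (4 a)\<close> comes from
    Young's inequality for \<open>q \<bullet> B p\<close>.\<close>
  define C where "C = 2 * \<alpha> + \<beta>\<^sup>2 / (4 * a)"
  have C: "C > 0" using \<alpha> \<beta> a by (simp add: C_def add_pos_pos)
  \<comment> \<open>The bound \<open>1/2\<close> keeps \<open>V\<close> comparable with the energy
    \<open>N\<close>; the bound \<open>b / (2 C)\<close> leaves half of the friction
    \<open>b\<close> after the price of the cross term is paid.\<close>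
  define \<epsilon> where "\<epsilon> = min (1/2) (b / (2 * C))"
  have "\<epsilon> * C \<le> b / (2 * C) * C" using C by (intro mult_right_mono) (auto simp: \<epsilon>_def)
  then have \<epsilon>: "\<epsilon> > 0" "\<epsilon> \<le> 1/2" "\<epsilon> * C \<le> b / 2"
    using C b(1) by (auto simp: \<epsilon>_def)
  define m where "m = min (b / 2) (\<epsilon> * a)"
  have m: "m > 0" using b \<epsilon> a by (simp add: m_def)
  define N V V' where "N t = (norm (q t))\<^sup>2 + (norm (p t))\<^sup>2"
    and "V t = q t \<bullet> q t + p t \<bullet> p t + 2 * \<epsilon> * (q t \<bullet> p t)"
    and "V' t = - (p t \<bullet> (B *v p t)) + 2 * \<epsilon> * (p t \<bullet> (A *v p t)) - 2 * \<epsilon> * (q t \<bullet> (A *v q t)) - \<epsilon> * (q t \<bullet> (B *v p t))" for t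
  have dV: "(V has_real_derivative V' t) (at t)" for t
  proof -
    note dinner = bounded_bilinear.has_vector_derivative[OF bounded_bilinear_inner]
    have "(V has_vector_derivative
        (q t \<bullet> (A *v p t) + (A *v p t) \<bullet> q t) + (p t \<bullet> (- (A *v q t) - (1/2) *\<^sub>R (B *v p t))
          + (- (A *v q t) - (1/2) *\<^sub>R (B *v p t)) \<bullet> p t)
        + 2 * \<epsilon> * (q t \<bullet> (- (A *v q t) - (1/2) *\<^sub>R (B *v p t)) + (A *v p t) \<bullet> p t)) (at t)"
      unfolding V_def[abs_def]
      by (intro has_vector_derivative_add has_vector_derivative_mult_right dinner q p)
    moreover have "(A *v p t) \<bullet> q t = p t \<bullet> (A *v q t)" "q t \<bullet> (A *v p t) = p t \<bullet> (A *v q t)"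
      by (metis symA inner_commute)+
    ultimately show ?thesis
      unfolding V'_def has_real_derivative_iff_has_vector_derivative
      by (simp add: inner_simps inner_commute[of _ "p t"] algebra_simps)
  qed
  have cross: "\<bar>2 * \<epsilon> * (q t \<bullet> p t)\<bar> \<le> N t / 2" for t
  proof -
    have "\<bar>2 * \<epsilon> * (q t \<bullet> p t)\<bar> = 2 * \<epsilon> * \<bar>q t \<bullet> p t\<bar>" using \<epsilon>(1) by (simp add: abs_mult)
    also have "\<dots> \<le> 1 * (norm (q t) * norm (p t))"
      using \<epsilon> by (intro mult_mono Cauchy_Schwarz_ineq2) auto
    also have "\<dots> \<le> N t / 2" using sum_squares_bound[of "norm (q t)" "norm (p t)"] by (simp add: N_def)
    finally show ?thesis .
  qed
  have VN: "N t \<le> 2 * V t" "V t \<le> 2 * N t" for t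
    using cross[of t] by (auto simp: V_def N_def power2_norm_eq_inner abs_le_iff)
  have V'N: "V' t \<le> - m * N t" for t
  proof -
    have "p t \<bullet> (A *v p t) \<le> norm (p t) * (norm (p t) * \<alpha>)"
      by (rule order_trans[OF norm_cauchy_schwarz]) (intro mult_left_mono \<alpha>, simp)
    then have 1: "2 * \<epsilon> * (p t \<bullet> (A *v p t)) \<le> \<epsilon> * (2 * \<alpha>) * (norm (p t))\<^sup>2"
      using \<epsilon>(1) by (simp add: power2_eq_square mult_ac)
    have "- (q t \<bullet> (B *v p t)) \<le> norm (q t) * (norm (p t) * \<beta>)"
      by (rule order_trans[OF _ order_trans[OF Cauchy_Schwarz_ineq2]])
        (auto intro!: mult_left_mono \<beta>)
    \<comment> \<open>The weights in Young's inequality are tuned so that, after multiplication by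
      \<open>\<epsilon>\<close>, exactly half of the gain
      \<open>2 \<epsilon> a (norm (q t))\<^sup>2\<close> is spent.\<close>
    also have "\<dots> \<le> a * (norm (q t))\<^sup>2 + \<beta>\<^sup>2 / (4 * a) * (norm (p t))\<^sup>2"
    proof -
      have "0 \<le> (2 * a * norm (q t) - \<beta> * norm (p t))\<^sup>2 / (4 * a)" using a by simp
      also have "\<dots> = a * (norm (q t))\<^sup>2 + \<beta>\<^sup>2 / (4 * a) * (norm (p t))\<^sup>2 - norm (q t) * (norm (p t) * \<beta>)"
        using a by (simp add: field_simps power2_eq_square)
      finally show ?thesis by simp
    qed
    finally have "- (q t \<bullet> (B *v p t)) \<le> a * (norm (q t))\<^sup>2 + \<beta>\<^sup>2 / (4 * a) * (norm (p t))\<^sup>2" .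
    from mult_left_mono[OF this, of \<epsilon>] \<epsilon>(1)
    have 2: "- \<epsilon> * (q t \<bullet> (B *v p t)) \<le> \<epsilon> * (a * (norm (q t))\<^sup>2 + \<beta>\<^sup>2 / (4 * a) * (norm (p t))\<^sup>2)"
      by simp
    have 3: "\<epsilon> * (a * (norm (q t))\<^sup>2) \<le> \<epsilon> * (q t \<bullet> (A *v q t))" using a \<epsilon>(1) by (intro mult_left_mono) auto
    have "V' t \<le> - b * (norm (p t))\<^sup>2 + \<epsilon> * C * (norm (p t))\<^sup>2 - \<epsilon> * a * (norm (q t))\<^sup>2"
      using 1 2 3 b(2)[of "p t"] by (simp add: V'_def C_def algebra_simps)
    also have "\<dots> \<le> - (b / 2) * (norm (p t))\<^sup>2 - \<epsilon> * a * (norm (q t))\<^sup>2"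
      using mult_right_mono[OF \<epsilon>(3), of "(norm (p t))\<^sup>2"] by (simp add: algebra_simps)
    also have "\<dots> \<le> - m * (norm (p t))\<^sup>2 - m * (norm (q t))\<^sup>2"
      by (intro diff_mono mult_right_mono) (auto simp: m_def)
    finally show ?thesis by (simp add: N_def algebra_simps)
  qed
  \<comment> \<open>The rate is \<open>m / 2\<close> because \<open>V' \<le> - m N\<close> and
    \<open>V \<le> 2 N\<close>.\<close>
  have "V t * exp (m / 2 * t) \<le> V 0 * exp (m / 2 * 0)" if "t \<ge> 0" for t
  proof (rule DERIV_nonpos_imp_nonincreasing[OF that])
    fix s
    have "((\<lambda>s. V s * exp (m / 2 * s)) has_real_derivative (V' s + m / 2 * V s) * exp (m / 2 * s)) (at s)"
      by (auto intro!: derivative_eq_intros dV simp: algebra_simps)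
    moreover have "m / 2 * V s \<le> m / 2 * (2 * N s)" using VN m by (intro mult_left_mono) auto
    then have "V' s + m / 2 * V s \<le> 0" using V'N[of s] by simp
    then have "(V' s + m / 2 * V s) * exp (m / 2 * s) \<le> 0" by (simp add: mult_nonpos_nonneg)
    ultimately show "\<exists>y. ((\<lambda>s. V s * exp (m / 2 * s)) has_real_derivative y) (at s) \<and> y \<le> 0" by blast
  qed
  then have Vexp: "V t * exp (m / 2 * t) \<le> V 0" if "t \<ge> 0" for t using that by fastforce
  have dec: "N t \<le> 2 * V 0 * exp (- (m / 2 * t))" if "t \<ge> 0" for t
  proof -
    have "V t = (V t * exp (m / 2 * t)) * exp (- (m / 2 * t))" by (simp add: exp_minus)
    also have "\<dots> \<le> V 0 * exp (- (m / 2 * t))" by (intro mult_right_mono Vexp that) simp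
    finally show ?thesis using VN(1)[of t] by linarith
  qed
  have "filterlim (\<lambda>t. m / 2 * t) at_top at_top"
    by (intro filterlim_tendsto_pos_mult_at_top[OF tendsto_const _ filterlim_ident]) (use m in simp)
  then have "((\<lambda>t. exp (- (m / 2 * t))) \<longlongrightarrow> 0) at_top"
    by (intro filterlim_compose[OF exp_at_bot]) (simp add: filterlim_uminus_at_bot)
  then have "((\<lambda>t. 2 * V 0 * exp (- (m / 2 * t))) \<longlongrightarrow> 0) at_top"
    by (rule tendsto_mult_right_zero)
  then have "(N \<longlongrightarrow> 0) at_top"
  proof (rule tendsto_sandwich[OF _ _ tendsto_const, rotated 2])
    show "\<forall>\<^sub>F t in at_top. N t \<le> 2 * V 0 * exp (- (m / 2 * t))"
      using eventually_ge_at_top[of 0] by eventually_elim (rule dec)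
  qed (simp add: N_def)
  then show ?thesis by (simp add: N_def[abs_def])
qed

subsection \<open>Gaussian smoothing and the continuity theorem\<close>

text \<open>It serves twice: as the density of the limit law and as the smoothing kernel in the
  continuity theorem.\<close>

definition gaussian_density :: "real \<Rightarrow> 'a::euclidean_space \<Rightarrow> real" where
  "gaussian_density v x =
     (2 * pi * v) powr (- real DIM('a) / 2) * exp (- (norm x)\<^sup>2 / (2 * v))"

lemma isotropic_gaussian_eq: "isotropic_gaussian v = density lborel (\<lambda>x. ennreal (gaussian_density v x))"
  by (simp add: isotropic_gaussian_def gaussian_density_def)

lemma gaussian_density_nonneg [simp]: "0 \<le> gaussian_density v x"
  by (simp add: gaussian_density_def)

lemma gaussian_density_le:
  fixes x :: "'a::euclidean_space"
  assumes "v > 0"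
  shows "gaussian_density v x \<le> (2 * pi * v) powr (- real DIM('a) / 2)"
  using assms by (auto simp: gaussian_density_def intro!: mult_left_le)

lemma borel_measurable_gaussian_density [measurable]: "gaussian_density v \<in> borel_measurable borel"
  unfolding gaussian_density_def by measurable

lemma sets_isotropic_gaussian [simp, measurable_cong]: "sets (isotropic_gaussian v) = sets borel"
  by (simp add: isotropic_gaussian_eq)

lemma space_isotropic_gaussian [simp]: "space (isotropic_gaussian v) = UNIV"
  by (simp add: isotropic_gaussian_eq)

lemma gaussian_density_prod:
  fixes x :: "'a::euclidean_space"
  assumes "v > 0"
  shows "gaussian_density v x = (\<Prod>b\<in>Basis. normal_density 0 (sqrt v) (x \<bullet> b))"
proof -
  have "(\<Prod>b\<in>(Basis :: 'a set). 1 / sqrt (2 * pi * v)) = (2 * pi * v) powr (- real DIM('a) / 2)"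
    using assms by (simp add: powr_half_sqrt [symmetric] powr_minus_divide powr_power power_one_over flip: powr_realpow)
      (simp add: powr_powr)
  moreover have "(\<Prod>b\<in>Basis. exp (- (x \<bullet> b)\<^sup>2 / (2 * v))) = exp (- (norm x)\<^sup>2 / (2 * v))"
    unfolding exp_sum[symmetric, OF finite_Basis] power2_norm_eq_inner
    by (subst euclidean_inner) (simp add: sum_negf sum_divide_distrib power2_eq_square)
  ultimately show ?thesis
    using assms unfolding gaussian_density_def normal_density_def
    by (simp only: prod.distrib diff_0_right real_sqrt_pow2 less_imp_le)
qed

lemma normal_density_char:
  assumes "\<sigma> > 0"
  shows "(\<integral>y. normal_density 0 \<sigma> y *\<^sub>R iexp (t * y) \<partial>lborel) = complex_of_real (exp (- (\<sigma>\<^sup>2 * t\<^sup>2) / 2))"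
proof -
  have scale: "\<sigma> * normal_density 0 \<sigma> (\<sigma> * z) = std_normal_density z" for z
    using assms by (simp add: normal_density_def real_sqrt_mult power_mult_distrib field_simps)
  \<comment> \<open>Substituting \<open>y = \<sigma> z\<close> reduces the claim to the standard
    normal distribution at frequency \<open>\<sigma> t\<close>.\<close>
  have "(\<integral>y. normal_density 0 \<sigma> y *\<^sub>R iexp (t * y) \<partial>lborel)
      = \<sigma> *\<^sub>R (\<integral>z. normal_density 0 \<sigma> (\<sigma> * z) *\<^sub>R iexp (t * (\<sigma> * z)) \<partial>lborel)"
    using assms lborel_integral_real_affine[of \<sigma> "\<lambda>y. normal_density 0 \<sigma> y *\<^sub>R iexp (t * y)" 0]
    by simp
  also have "\<dots> = (\<integral>z. std_normal_density z *\<^sub>R iexp ((\<sigma> * t) * z) \<partial>lborel)"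
    unfolding integral_scaleR_right[symmetric]
    by (intro Bochner_Integration.integral_cong) (auto simp: mult_ac simp flip: scale)
  also have "\<dots> = char std_normal_distribution (\<sigma> * t)"
    unfolding char_def by (subst integral_density) auto
  finally show ?thesis by (simp add: char_std_normal_distribution power_mult_distrib)
qed

text \<open>Density and exponential both factor over the coordinates, and \<open>lborel\<close> is
  the image of a product measure, so the integral is a product of one-dimensional ones.\<close>

lemma gaussian_char:
  fixes \<xi> :: "'a::euclidean_space"
  assumes v: "v > 0"
  shows "(\<integral>x. iexp (\<xi> \<bullet> x) \<partial>isotropic_gaussian v) = complex_of_real (exp (- (v * (norm \<xi>)\<^sup>2) / 2))"
proof -
  interpret product_sigma_finite "\<lambda>_::'a. lborel :: real measure" ..
  let ?g = "\<lambda>b y. normal_density 0 (sqrt v) y *\<^sub>R iexp ((\<xi> \<bullet> b) * y)"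
  have "iexp (\<xi> \<bullet> x) = (\<Prod>b\<in>Basis. iexp ((\<xi> \<bullet> b) * (x \<bullet> b)))" for x
    by (subst euclidean_inner) (simp add: sum_distrib_left exp_sum)
  then have *: "gaussian_density v x *\<^sub>R iexp (\<xi> \<bullet> x) = (\<Prod>b\<in>Basis. ?g b (x \<bullet> b))" for x
    unfolding gaussian_density_prod[OF v] scaleR_conv_of_real of_real_prod prod.distrib
    by simp
  have "(\<integral>x. iexp (\<xi> \<bullet> x) \<partial>isotropic_gaussian v) = (\<integral>x. gaussian_density v x *\<^sub>R iexp (\<xi> \<bullet> x) \<partial>lborel)"
    unfolding isotropic_gaussian_eq by (subst integral_density) auto
  also have "\<dots> = (\<integral>x. (\<Prod>b\<in>Basis. ?g b (x \<bullet> b)) \<partial>(lborel::'a measure))"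
    by (simp only: *)
  also have "\<dots> = (\<integral>y. (\<Prod>b\<in>Basis. ?g b (y b)) \<partial>Pi\<^sub>M (Basis :: 'a set) (\<lambda>_. lborel))"
    unfolding lborel_eq[where 'a='a] by (subst integral_distr) (auto intro!: Bochner_Integration.integral_cong prod.cong)
  also have "\<dots> = (\<Prod>b\<in>(Basis :: 'a set). \<integral>y. ?g b y \<partial>lborel)"
  proof (rule product_integral_prod)
    fix b :: 'a
    show "integrable lborel (?g b)"
      by (rule Bochner_Integration.integrable_bound[of _ "normal_density 0 (sqrt v)"]) (use v in auto)
  qed simp
  also have "\<dots> = (\<Prod>b\<in>(Basis :: 'a set). complex_of_real (exp (- (v * (\<xi> \<bullet> b)\<^sup>2) / 2)))"
    using v by (intro prod.cong refl) (subst normal_density_char, auto)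
  also have "\<dots> = complex_of_real (exp (- (v * (norm \<xi>)\<^sup>2) / 2))"
    unfolding of_real_prod[symmetric] exp_sum[symmetric, OF finite_Basis] power2_norm_eq_inner
    by (subst euclidean_inner) (simp add: sum_negf sum_divide_distrib power2_eq_square sum_distrib_left)
  finally show ?thesis .
qed

text \<open>The total mass is the value of the characteristic function at frequency 0.\<close>

lemma prob_space_isotropic_gaussian:
  assumes "v > 0"
  shows "prob_space (isotropic_gaussian v :: 'a::euclidean_space measure)"
proof
  have "complex_of_real (measure (isotropic_gaussian v :: 'a measure) UNIV) = 1"
    using gaussian_char[OF assms, of "0::'a"] by (simp add: scaleR_conv_of_real)
  then have "measure (isotropic_gaussian v :: 'a measure) UNIV = 1" by (simp only: of_real_eq_1_iff)
  then show "emeasure (isotropic_gaussian v) (space (isotropic_gaussian v :: 'a measure)) = 1"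
    \<comment> \<open>An infinite mass would have \<open>measure\<close> equal to 0 by convention,
      so the value 1 excludes it.\<close>
    by (cases "emeasure (isotropic_gaussian v) (UNIV :: 'a set) = \<infinity>")
      (simp_all add: emeasure_eq_ennreal_measure measure_def)
qed

text \<open>A Gaussian density is, up to a constant, the characteristic function of a Gaussian law.
  This self-duality lets smoothed measures be expressed through characteristic functions without
  Fourier inversion.\<close>

lemma gaussian_density_fourier:
  fixes z :: "'a::euclidean_space"
  assumes "\<sigma> > 0"
  shows "complex_of_real (gaussian_density (\<sigma>\<^sup>2) z) =
    (2 * pi * \<sigma>\<^sup>2) powr (- real DIM('a) / 2) * (\<integral>\<eta>. iexp ((z /\<^sub>R \<sigma>) \<bullet> \<eta>) \<partial>standard_gaussian)"
  by (subst gaussian_char) (use assms in \<open>auto simp: gaussian_density_def power_mult_distrib field_simps\<close>)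

text \<open>By self-duality and Fubini, the density of the smoothed measure at \<open>y\<close> is a
  Gaussian average over \<open>\<eta>\<close> of its characteristic function at
  \<open>- \<eta> /\<^sub>R \<sigma>\<close>, times a factor of modulus 1. Pointwise convergence of
  characteristic functions then passes through the average by domination with the constant
  1.\<close>

lemma gaussian_convolution_tendsto:
  fixes \<mu> :: "real \<Rightarrow> 'a::euclidean_space measure"
  assumes \<mu>: "\<And>s. prob_space (\<mu> s)" "\<And>s. sets (\<mu> s) = sets borel"
    and \<nu>: "prob_space \<nu>" "sets \<nu> = sets borel"
    and char: "\<And>\<xi>. ((\<lambda>s. \<integral>x. iexp (\<xi> \<bullet> x) \<partial>\<mu> s) \<longlongrightarrow> (\<integral>x. iexp (\<xi> \<bullet> x) \<partial>\<nu>)) at_top"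
    and \<sigma>: "\<sigma> > 0"
  shows "((\<lambda>s. \<integral>x. gaussian_density (\<sigma>\<^sup>2) (y - x) \<partial>\<mu> s) \<longlongrightarrow> (\<integral>x. gaussian_density (\<sigma>\<^sup>2) (y - x) \<partial>\<nu>)) at_top"
proof -
  let ?c = "complex_of_real ((2 * pi * \<sigma>\<^sup>2) powr (- real DIM('a) / 2))"
  let ?\<gamma> = "standard_gaussian :: 'a measure"
  let ?K = "\<lambda>\<rho> \<eta>. iexp ((y /\<^sub>R \<sigma>) \<bullet> \<eta>) * (\<integral>x. iexp ((- \<eta> /\<^sub>R \<sigma>) \<bullet> x) \<partial>\<rho>)"
  interpret \<gamma>: prob_space ?\<gamma> by (rule prob_space_isotropic_gaussian) simp
  have meas[measurable]: "?K \<rho> \<in> borel_measurable borel"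
    and eq: "complex_of_real (\<integral>x. gaussian_density (\<sigma>\<^sup>2) (y - x) \<partial>\<rho>) = ?c * (\<integral>\<eta>. ?K \<rho> \<eta> \<partial>?\<gamma>)"
    and bd: "norm (?K \<rho> \<eta>) \<le> 1"
    if "prob_space \<rho>" and [measurable_cong]: "sets \<rho> = sets borel" for \<rho> \<eta>
  proof -
    interpret \<rho>: prob_space \<rho> by fact
    interpret P: pair_prob_space \<rho> ?\<gamma> ..
    show "?K \<rho> \<in> borel_measurable borel" by measurable
    have "norm (\<integral>x. iexp ((- \<eta> /\<^sub>R \<sigma>) \<bullet> x) \<partial>\<rho>) \<le> 1" 
      using integral_norm_bound[of \<rho> "\<lambda>x. iexp ((- \<eta> /\<^sub>R \<sigma>) \<bullet> x)"] by (simp add: \<rho>.prob_space)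
    then show "norm (?K \<rho> \<eta>) \<le> 1" by (simp add: norm_mult)
    have split: "iexp (((y - x) /\<^sub>R \<sigma>) \<bullet> \<eta>) = iexp ((y /\<^sub>R \<sigma>) \<bullet> \<eta>) * iexp ((- \<eta> /\<^sub>R \<sigma>) \<bullet> x)" for x \<eta>
      unfolding exp_add[symmetric] by (simp add: inner_simps inner_commute algebra_simps)
    have "complex_of_real (\<integral>x. gaussian_density (\<sigma>\<^sup>2) (y - x) \<partial>\<rho>)
        = (\<integral>x. ?c * (\<integral>\<eta>. iexp (((y - x) /\<^sub>R \<sigma>) \<bullet> \<eta>) \<partial>?\<gamma>) \<partial>\<rho>)"
      unfolding integral_complex_of_real[symmetric] by (subst gaussian_density_fourier[OF \<sigma>]) simp
    also have "\<dots> = ?c * (\<integral>x. (\<integral>\<eta>. iexp (((y - x) /\<^sub>R \<sigma>) \<bullet> \<eta>) \<partial>?\<gamma>) \<partial>\<rho>)"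
      by simp
    also have "(\<integral>x. (\<integral>\<eta>. iexp (((y - x) /\<^sub>R \<sigma>) \<bullet> \<eta>) \<partial>?\<gamma>) \<partial>\<rho>) = (\<integral>\<eta>. (\<integral>x. iexp (((y - x) /\<^sub>R \<sigma>) \<bullet> \<eta>) \<partial>\<rho>) \<partial>?\<gamma>)"
      by (rule P.Fubini_integral[symmetric], rule P.integrable_const_bound[where B=1]) auto
    also have "\<dots> = (\<integral>\<eta>. ?K \<rho> \<eta> \<partial>?\<gamma>)"
      by (simp only: split integral_mult_right_zero)
    finally show "complex_of_real (\<integral>x. gaussian_density (\<sigma>\<^sup>2) (y - x) \<partial>\<rho>) = ?c * (\<integral>\<eta>. ?K \<rho> \<eta> \<partial>?\<gamma>)" .
  qed
  have "((\<lambda>s. \<integral>\<eta>. ?K (\<mu> s) \<eta> \<partial>?\<gamma>) \<longlongrightarrow> (\<integral>\<eta>. ?K \<nu> \<eta> \<partial>?\<gamma>)) at_top"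
  proof (rule integral_dominated_convergence_at_top[where w="\<lambda>_. 1"])
    show "?K \<nu> \<in> borel_measurable ?\<gamma>" using meas[OF \<nu>] by simp
    show "?K (\<mu> s) \<in> borel_measurable ?\<gamma>" for s using meas[OF \<mu>] by simp
    show "\<forall>\<^sub>F s in at_top. AE \<eta> in ?\<gamma>. norm (?K (\<mu> s) \<eta>) \<le> 1" using bd[OF \<mu>] by simp
    show "AE \<eta> in ?\<gamma>. ((\<lambda>s. ?K (\<mu> s) \<eta>) \<longlongrightarrow> ?K \<nu> \<eta>) at_top"
      by (intro AE_I2 tendsto_intros char)
  qed simp
  then have "((\<lambda>s. complex_of_real (\<integral>x. gaussian_density (\<sigma>\<^sup>2) (y - x) \<partial>\<mu> s)) \<longlongrightarrow>
      complex_of_real (\<integral>x. gaussian_density (\<sigma>\<^sup>2) (y - x) \<partial>\<nu>)) at_top"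
    unfolding eq[OF \<mu>] eq[OF \<nu>] by (intro tendsto_intros)
  then show ?thesis by (simp add: tendsto_of_real_iff)
qed

text \<open>Under \<open>y = x + \<sigma> z\<close> the Jacobian \<open>\<sigma> ^ DIM('a)\<close>
  cancels the scaling of the normalising constant. Smoothing becomes an average over a measure
  independent of \<open>x\<close> and \<open>\<sigma>\<close>.\<close>

lemma gaussian_smoothing_eq:
  fixes f :: "'a::euclidean_space \<Rightarrow> real"
  assumes \<sigma>: "\<sigma> > 0" and [measurable]: "f \<in> borel_measurable borel"
  shows "(\<integral>y. f y * gaussian_density (\<sigma>\<^sup>2) (y - x) \<partial>lborel) = (\<integral>z. f (x + \<sigma> *\<^sub>R z) \<partial>standard_gaussian)"
proof -
  have "\<sigma> ^ DIM('a) * gaussian_density (\<sigma>\<^sup>2) (\<sigma> *\<^sub>R z) = gaussian_density 1 z" for z :: 'a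
  proof -
    have "\<sigma> ^ DIM('a) = (\<sigma>\<^sup>2) powr (real DIM('a) / 2)"
      using powr_powr[of \<sigma> 2 "real DIM('a) / 2"] \<sigma> by (simp add: powr_realpow)
    then have "\<sigma> ^ DIM('a) * (2 * pi * \<sigma>\<^sup>2) powr (- real DIM('a) / 2) = (2 * pi) powr (- real DIM('a) / 2)"
      using \<sigma> by (simp add: powr_mult powr_minus field_simps)
    moreover have "- (norm (\<sigma> *\<^sub>R z))\<^sup>2 / (2 * \<sigma>\<^sup>2) = - (norm z)\<^sup>2 / 2"
      using \<sigma> by (simp add: power_mult_distrib)
    ultimately show ?thesis
      by (simp add: gaussian_density_def flip: mult.assoc)
  qed
  from arg_cong[OF this, of "\<lambda>r. r * f _"]
  have *: "\<sigma> ^ DIM('a) *\<^sub>R (f (x + \<sigma> *\<^sub>R z) * gaussian_density (\<sigma>\<^sup>2) (\<sigma> *\<^sub>R z))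
      = gaussian_density 1 z *\<^sub>R f (x + \<sigma> *\<^sub>R z)" for z
    by (simp add: mult_ac)
  have "(\<integral>y. f y * gaussian_density (\<sigma>\<^sup>2) (y - x) \<partial>lborel)
      = (\<integral>z. \<sigma> ^ DIM('a) *\<^sub>R (f (x + \<sigma> *\<^sub>R z) * gaussian_density (\<sigma>\<^sup>2) (\<sigma> *\<^sub>R z)) \<partial>lborel)"
    using \<sigma> by (subst lborel_affine[of \<sigma> x]) (simp_all add: integral_density integral_distr)
  also have "\<dots> = (\<integral>z. f (x + \<sigma> *\<^sub>R z) \<partial>standard_gaussian)"
    unfolding * isotropic_gaussian_eq by (subst integral_density) auto
  finally show ?thesis .
qed

lemma gaussian_smoothing_uniform:
  fixes f :: "'a::euclidean_space \<Rightarrow> real"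
  assumes uc: "uniformly_continuous_on UNIV f" and bd: "\<And>x. \<bar>f x\<bar> \<le> B" and e: "e > 0"
  obtains \<sigma> where "\<sigma> > 0" "\<And>x. \<bar>(\<integral>y. f y * gaussian_density (\<sigma>\<^sup>2) (y - x) \<partial>lborel) - f x\<bar> \<le> e"
proof -
  let ?\<gamma> = "standard_gaussian :: 'a measure"
  interpret \<gamma>: prob_space ?\<gamma> by (rule prob_space_isotropic_gaussian) simp
  have B: "B \<ge> 0" using bd[of 0] by linarith
  have [measurable]: "f \<in> borel_measurable borel"
    using uc by (intro borel_measurable_continuous_onI uniformly_continuous_imp_continuous)
  define C where "C n = - ball (0::'a) (real n)" for n
  have "(\<lambda>n. measure ?\<gamma> (C n)) \<longlonglongrightarrow> measure ?\<gamma> (\<Inter>n. C n)"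
    by (rule \<gamma>.finite_Lim_measure_decseq) (auto simp: C_def decseq_def)
  moreover have "(\<Inter>n. C n) = {}"
    by (auto simp: C_def not_less) (meson not_le reals_Archimedean2)
  ultimately have "(\<lambda>n. measure ?\<gamma> (C n)) \<longlonglongrightarrow> 0" by simp
  \<comment> \<open>Outside the ball the integrand is at most \<open>2 B\<close>, so this tail mass
    costs at most \<open>e / 2\<close>; the \<open>+ 1\<close> covers \<open>B = 0\<close>.\<close>
  moreover have "e / (2 * (2 * B + 1)) > 0" using B e by simp
  ultimately obtain n where n: "measure ?\<gamma> (C n) < e / (2 * (2 * B + 1))"
    by (metis (no_types, lifting) eventually_sequentially order_refl order_tendstoD(2))
  obtain d where d: "d > 0" "\<And>x y. dist x y < d \<Longrightarrow> dist (f x) (f y) < e / 2"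
    using uc e unfolding uniformly_continuous_on_def by (metis UNIV_I half_gt_zero dist_commute)
  \<comment> \<open>This makes \<open>\<sigma> z\<close> shorter than the modulus of continuity
    \<open>d\<close> for all \<open>z\<close> in the ball of radius \<open>n\<close>; the
    \<open>+ 1\<close> covers \<open>n = 0\<close>.\<close>
  define \<sigma> where "\<sigma> = d / (real n + 1)"
  have \<sigma>: "\<sigma> > 0" using d by (simp add: \<sigma>_def)
  have "\<bar>(\<integral>z. f (x + \<sigma> *\<^sub>R z) \<partial>?\<gamma>) - f x\<bar> \<le> e" for x
  proof -
    have int: "integrable ?\<gamma> (\<lambda>z. f (x + \<sigma> *\<^sub>R z))"
      by (rule \<gamma>.integrable_const_bound[where B=B]) (use bd in auto)
    have pt: "\<bar>f (x + \<sigma> *\<^sub>R z) - f x\<bar> \<le> e / 2 + 2 * B * indicator (C n) z" for z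
    proof (cases "z \<in> C n")
      case True
      then show ?thesis using bd[of x] bd[of "x + \<sigma> *\<^sub>R z"] e by simp
    next
      case False
      then have "norm z < real n + 1" by (simp add: C_def)
      then have "dist (x + \<sigma> *\<^sub>R z) x < d"
        using d(1) by (simp add: dist_norm \<sigma>_def divide_less_eq mult.commute)
      then show ?thesis using d(2)[of "x + \<sigma> *\<^sub>R z" x] False by (simp add: dist_real_def)
    qed
    have "\<bar>(\<integral>z. f (x + \<sigma> *\<^sub>R z) \<partial>?\<gamma>) - f x\<bar> = \<bar>\<integral>z. f (x + \<sigma> *\<^sub>R z) - f x \<partial>?\<gamma>\<bar>"
      using int \<gamma>.prob_space by simp
    also have "\<dots> \<le> (\<integral>z. \<bar>f (x + \<sigma> *\<^sub>R z) - f x\<bar> \<partial>?\<gamma>)"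
      by (rule integral_abs_bound)
    also have "\<dots> \<le> (\<integral>z. e / 2 + 2 * B * indicator (C n) z \<partial>?\<gamma>)"
      using int by (intro integral_mono pt) (auto simp: C_def less_top[symmetric] intro!: Bochner_Integration.integrable_add)
    also have "\<dots> = e / 2 + 2 * B * measure ?\<gamma> (C n)"
      using \<gamma>.prob_space by (subst Bochner_Integration.integral_add) (auto simp: C_def less_top[symmetric])
    also have "\<dots> \<le> e / 2 + (2 * B + 1) * (e / (2 * (2 * B + 1)))"
      using n B by (intro add_left_mono mult_mono) auto
    also have "\<dots> = e" using B by (simp add: field_simps)
    finally show ?thesis .
  qed
  then show ?thesis using that[OF \<sigma>] gaussian_smoothing_eq[OF \<sigma>, of f] by simp
qed

section \<open>From characteristic functions to weak convergence\<close>

text \<open>A collar of width 1 separates two cases: of two points closer than 1, either both lie in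
  the compact ball of radius \<open>K + 1\<close>, or both lie outside the ball of radius
  \<open>K\<close>, where \<open>f\<close> vanishes.\<close>

lemma compact_support_uniformly_continuous:
  fixes f :: "'a::euclidean_space \<Rightarrow> real"
  assumes cont: "continuous_on UNIV f" and supp: "\<And>x. x \<notin> cball 0 K \<Longrightarrow> f x = 0"
  shows "uniformly_continuous_on UNIV f"
  unfolding uniformly_continuous_on_def
proof (intro allI impI)
  fix e :: real assume "e > 0"
  have "uniformly_continuous_on (cball 0 (K + 1)) f"
    by (rule compact_uniformly_continuous) (use cont continuous_on_subset in auto)
  then obtain d where d: "d > 0"
    "\<And>x y. x \<in> cball 0 (K + 1) \<Longrightarrow> y \<in> cball 0 (K + 1) \<Longrightarrow> dist y x < d \<Longrightarrow> dist (f y) (f x) < e"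
    using \<open>e > 0\<close> unfolding uniformly_continuous_on_def by meson
  have "dist (f y) (f x) < e" if "dist y x < min d 1" for x y
  proof (cases "x \<in> cball 0 (K + 1) \<and> y \<in> cball 0 (K + 1)")
    case True
    then show ?thesis using d that by simp
  next
    case False
    have "norm y \<le> norm x + dist y x" "norm x \<le> norm y + dist y x"
      unfolding dist_norm by (norm | metis norm_minus_commute norm_triangle_sub)+
    then have "x \<notin> cball 0 K \<and> y \<notin> cball 0 K" using that False by auto
    then show ?thesis using supp \<open>e > 0\<close> by simp
  qed
  then show "\<exists>d>0. \<forall>x\<in>UNIV. \<forall>y\<in>UNIV. dist y x < d \<longrightarrow> dist (f y) (f x) < e"
    using d(1) by (intro exI[of _ "min d 1"]) auto
qed

text \<open>Integrating the smoothed \<open>f\<close> against a measure equals integrating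
  \<open>f\<close> against the smoothed density, for which convergence is known pointwise; compact
  support makes \<open>f\<close> integrable and supplies the dominating function. The smoothing
  error is uniform in \<open>x\<close>, hence the same for every probability measure, which permits
  an \<open>e / 3\<close> argument.\<close>

lemma vague_convergence_of_char:
  fixes \<mu> :: "real \<Rightarrow> 'a::euclidean_space measure" and f :: "'a \<Rightarrow> real"
  assumes \<mu>: "\<And>s. prob_space (\<mu> s)" "\<And>s. sets (\<mu> s) = sets borel"
    and \<nu>: "prob_space \<nu>" "sets \<nu> = sets borel"
    and char: "\<And>\<xi>. ((\<lambda>s. \<integral>x. iexp (\<xi> \<bullet> x) \<partial>\<mu> s) \<longlongrightarrow> (\<integral>x. iexp (\<xi> \<bullet> x) \<partial>\<nu>)) at_top"
    and cont: "continuous_on UNIV f" and supp: "\<And>x. x \<notin> cball 0 K \<Longrightarrow> f x = 0"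
  shows "((\<lambda>s. \<integral>x. f x \<partial>\<mu> s) \<longlongrightarrow> (\<integral>x. f x \<partial>\<nu>)) at_top"
proof -
  have fm[measurable]: "f \<in> borel_measurable borel"
    using cont by (rule borel_measurable_continuous_onI)
  have uc: "uniformly_continuous_on UNIV f"
    using cont supp by (rule compact_support_uniformly_continuous)
  have "compact (f ` cball 0 K)"
    by (intro compact_continuous_image continuous_on_subset[OF cont]) auto
  then obtain B0 where "\<forall>x\<in>cball 0 K. \<bar>f x\<bar> \<le> B0"
    by (auto dest!: compact_imp_bounded simp: bounded_real)
  then have B: "\<bar>f x\<bar> \<le> \<bar>B0\<bar>" for x
    by (cases "x \<in> cball 0 K") (use supp[of x] in \<open>auto intro: order_trans[OF _ abs_ge_self]\<close>)
  have "(\<lambda>x. indicator (cball 0 K) x *\<^sub>R f x) = f"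
    by (rule ext) (use supp in \<open>auto simp: indicator_def\<close>)
  then have fint: "integrable lborel f"
    using borel_integrable_compact[of "cball 0 K" f] continuous_on_subset[OF cont] by auto
  have smooth: "((\<lambda>s. \<integral>x. (\<integral>y. f y * gaussian_density (\<sigma>\<^sup>2) (y - x) \<partial>lborel) \<partial>\<mu> s)
      \<longlongrightarrow> (\<integral>x. (\<integral>y. f y * gaussian_density (\<sigma>\<^sup>2) (y - x) \<partial>lborel) \<partial>\<nu>)) at_top"
    if \<sigma>: "\<sigma> > 0" for \<sigma>
  proof -
    define c where "c = (2 * pi * \<sigma>\<^sup>2) powr (- real DIM('a) / 2)"
    have gc: "gaussian_density (\<sigma>\<^sup>2) x \<le> c" for x :: 'a
      unfolding c_def using \<sigma> by (intro gaussian_density_le) simp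
    have c: "c \<ge> 0" by (simp add: c_def)
    let ?G = "\<lambda>\<rho> y. \<integral>x. gaussian_density (\<sigma>\<^sup>2) (y - x) \<partial>\<rho>"
    have swap: "(\<integral>x. (\<integral>y. f y * gaussian_density (\<sigma>\<^sup>2) (y - x) \<partial>lborel) \<partial>\<rho>) = (\<integral>y. f y * ?G \<rho> y \<partial>lborel)"
      and meas: "(\<lambda>y. f y * ?G \<rho> y) \<in> borel_measurable lborel"
      and bd: "norm (f y * ?G \<rho> y) \<le> c * \<bar>f y\<bar>"
      if "prob_space \<rho>" and [measurable_cong]: "sets \<rho> = sets borel" for \<rho> y
    proof -
      interpret \<rho>: prob_space \<rho> by fact
      interpret P: pair_sigma_finite \<rho> lborel ..
      have fin: "integrable lborel (\<lambda>y. f y * gaussian_density (\<sigma>\<^sup>2) (y - x))" for x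
        by (rule Bochner_Integration.integrable_bound[of _ "\<lambda>y. c * f y"])
          (use gc c in \<open>auto intro!: fint simp: abs_mult mult.commute[of c] intro!: mult_left_mono\<close>)
      have "(\<integral>y. norm (f y * gaussian_density (\<sigma>\<^sup>2) (y - x)) \<partial>lborel) \<le> (\<integral>y. c * \<bar>f y\<bar> \<partial>lborel)" for x
        by (intro integral_mono integrable_norm fin integrable_mult_right integrable_abs fint)
          (use gc c in \<open>auto simp: abs_mult mult.commute[of c] intro!: mult_left_mono\<close>)
      then have "integrable \<rho> (\<lambda>x. \<integral>y. norm (f y * gaussian_density (\<sigma>\<^sup>2) (y - x)) \<partial>lborel)"
        by (intro \<rho>.integrable_const_bound[where B="\<integral>y. c * \<bar>f y\<bar> \<partial>lborel"]) auto
      then have "integrable (\<rho> \<Otimes>\<^sub>M lborel) (\<lambda>(x, y). f y * gaussian_density (\<sigma>\<^sup>2) (y - x))"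
        by (intro P.Fubini_integrable) (auto simp: fin)
      from P.Fubini_integral[OF this, symmetric]
      show "(\<integral>x. (\<integral>y. f y * gaussian_density (\<sigma>\<^sup>2) (y - x) \<partial>lborel) \<partial>\<rho>) = (\<integral>y. f y * ?G \<rho> y \<partial>lborel)"
        by simp
      show "(\<lambda>y. f y * ?G \<rho> y) \<in> borel_measurable lborel" by measurable
      have "\<bar>?G \<rho> y\<bar> = ?G \<rho> y" by (intro abs_of_nonneg integral_nonneg) simp
      also have "\<dots> \<le> (\<integral>x. c \<partial>\<rho>)" by (intro integral_mono' gc c) simp_all
      finally have "\<bar>?G \<rho> y\<bar> \<le> (\<integral>x. c \<partial>\<rho>)" .
      then have "\<bar>?G \<rho> y\<bar> \<le> c" by (simp add: \<rho>.prob_space)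
      then show "norm (f y * ?G \<rho> y) \<le> c * \<bar>f y\<bar>"
        by (simp add: abs_mult mult.commute[of c] mult_left_mono)
    qed
    show ?thesis
      unfolding swap[OF \<mu>] swap[OF \<nu>]
    proof (rule integral_dominated_convergence_at_top[where w="\<lambda>y. c * \<bar>f y\<bar>"])
      show "AE y in lborel. ((\<lambda>s. f y * ?G (\<mu> s) y) \<longlongrightarrow> f y * ?G \<nu> y) at_top"
        by (intro AE_I2 tendsto_intros gaussian_convolution_tendsto \<mu> \<nu> char \<sigma>)
      show "\<forall>\<^sub>F s in at_top. AE y in lborel. norm (f y * ?G (\<mu> s) y) \<le> c * \<bar>f y\<bar>"
        using bd[OF \<mu>] by simp
    qed (use meas[OF \<mu>] meas[OF \<nu>] fint in auto)
  qed
  show ?thesis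
  proof (rule tendstoI)
    fix e :: real assume e: "e > 0"
    then have "e / 3 > 0" by simp
    with gaussian_smoothing_uniform[OF uc B] obtain \<sigma> where \<sigma>: "\<sigma> > 0"
      and ap: "\<And>x. \<bar>(\<integral>y. f y * gaussian_density (\<sigma>\<^sup>2) (y - x) \<partial>lborel) - f x\<bar> \<le> e / 3" by metis
    define g where "g x = (\<integral>y. f y * gaussian_density (\<sigma>\<^sup>2) (y - x) \<partial>lborel)" for x
    have ap: "\<bar>g x - f x\<bar> \<le> e / 3" for x using ap by (simp add: g_def)
    have close: "\<bar>(\<integral>x. g x \<partial>\<rho>) - (\<integral>x. f x \<partial>\<rho>)\<bar> \<le> e / 3"
      if "prob_space \<rho>" and [measurable_cong]: "sets \<rho> = sets borel" for \<rho>
    proof -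
      interpret \<rho>: prob_space \<rho> by fact
      have gm: "g \<in> borel_measurable \<rho>" unfolding g_def[abs_def] by measurable
      have i1: "integrable \<rho> f"
        by (rule \<rho>.integrable_const_bound[where B="\<bar>B0\<bar>"]) (use B in auto)
      have i2: "integrable \<rho> g"
      proof (rule \<rho>.integrable_const_bound[OF _ gm])
        have "\<bar>g x\<bar> \<le> \<bar>B0\<bar> + e / 3" for x using B[of x] ap[of x] by linarith
        then show "AE x in \<rho>. norm (g x) \<le> \<bar>B0\<bar> + e / 3" by simp
      qed
      have "\<bar>(\<integral>x. g x \<partial>\<rho>) - (\<integral>x. f x \<partial>\<rho>)\<bar> = \<bar>\<integral>x. g x - f x \<partial>\<rho>\<bar>" using i1 i2 by simp
      also have "\<dots> \<le> (\<integral>x. \<bar>g x - f x\<bar> \<partial>\<rho>)" by (rule integral_abs_bound)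
      also have "\<dots> \<le> (\<integral>x. e / 3 \<partial>\<rho>)" using i1 i2 ap by (intro integral_mono) auto
      finally show ?thesis by (simp add: \<rho>.prob_space)
    qed
    have "\<forall>\<^sub>F s in at_top. dist (\<integral>x. g x \<partial>\<mu> s) (\<integral>x. g x \<partial>\<nu>) < e / 3"
      using smooth[OF \<sigma>, folded g_def] \<open>e / 3 > 0\<close> by (rule tendstoD)
    then show "\<forall>\<^sub>F s in at_top. dist (\<integral>x. f x \<partial>\<mu> s) (\<integral>x. f x \<partial>\<nu>) < e"
    proof eventually_elim
      case (elim s)
      then show ?case using close[OF \<nu>] close[OF \<mu>, of s] unfolding dist_real_def by linarith
    qed
  qed
qed

text \<open>Compactly supported cutoffs reduce the claim to vague convergence. Tightness comes from
  the limit: the cutoffs have integral close to 1 under \<open>\<nu>\<close>, hence under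
  \<open>\<mu> s\<close> for large \<open>s\<close>, so no mass escapes to infinity.\<close>

theorem levy_continuity_euclidean:
  fixes \<mu> :: "real \<Rightarrow> 'a::euclidean_space measure"
  assumes \<mu>: "\<And>s. prob_space (\<mu> s)" "\<And>s. sets (\<mu> s) = sets borel"
    and \<nu>: "prob_space \<nu>" "sets \<nu> = sets borel"
    and char: "\<And>\<xi>. ((\<lambda>s. \<integral>x. iexp (\<xi> \<bullet> x) \<partial>\<mu> s) \<longlongrightarrow> (\<integral>x. iexp (\<xi> \<bullet> x) \<partial>\<nu>)) at_top"
  shows "converges_weakly \<mu> \<nu> at_top"
  unfolding converges_weakly_def
proof (intro allI impI)
  fix f :: "'a \<Rightarrow> real" assume cont: "continuous_on UNIV f" and "bounded (range f)"
  then obtain B where B: "\<And>x. \<bar>f x\<bar> \<le> B" by (auto simp: bounded_real)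
  then have B0: "B \<ge> 0" using B[of 0] by linarith
  have fm[measurable]: "f \<in> borel_measurable borel"
    using cont by (rule borel_measurable_continuous_onI)
  \<comment> \<open>The cutoff is 1 on the ball of radius \<open>n\<close>, 0 beyond radius
    \<open>n + 1\<close>, and linear in the norm between them.\<close>
  define \<kappa> :: "nat \<Rightarrow> 'a \<Rightarrow> real" where "\<kappa> n x = max 0 (min 1 (real n + 1 - norm x))" for n x
  have \<kappa>c: "continuous_on UNIV (\<kappa> n)" for n unfolding \<kappa>_def by (intro continuous_intros)
  then have \<kappa>m[measurable]: "\<kappa> n \<in> borel_measurable borel" for n by (rule borel_measurable_continuous_onI)
  have \<kappa>01: "0 \<le> \<kappa> n x" "\<kappa> n x \<le> 1" for n x by (auto simp: \<kappa>_def)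
  have supp: "\<kappa> n x = 0" if "x \<notin> cball 0 (real n + 1)" for n x using that by (auto simp: \<kappa>_def)
  interpret \<nu>: prob_space \<nu> by fact
  note [measurable_cong] = \<nu>(2)
  have "(\<lambda>n. \<integral>x. \<kappa> n x \<partial>\<nu>) \<longlonglongrightarrow> (\<integral>x. 1 \<partial>\<nu>)"
  proof (rule integral_dominated_convergence[where w="\<lambda>_. 1"])
    show "AE x in \<nu>. (\<lambda>n. \<kappa> n x) \<longlonglongrightarrow> 1"
    proof (intro AE_I2 tendsto_eventually)
      fix x
      show "\<forall>\<^sub>F n in sequentially. \<kappa> n x = 1"
        using eventually_ge_at_top[of "nat \<lceil>norm x\<rceil>"]
        by eventually_elim (auto simp: \<kappa>_def min_def nat_le_iff ceiling_le_iff)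
    qed
  qed (use \<kappa>01 in auto)
  then have \<kappa>lim: "(\<lambda>n. \<integral>x. \<kappa> n x \<partial>\<nu>) \<longlonglongrightarrow> 1" by (simp add: \<nu>.prob_space)
  have trunc: "\<bar>(\<integral>x. f x \<partial>\<rho>) - (\<integral>x. f x * \<kappa> n x \<partial>\<rho>)\<bar> \<le> B * (1 - (\<integral>x. \<kappa> n x \<partial>\<rho>))"
    if "prob_space \<rho>" and [measurable_cong]: "sets \<rho> = sets borel" for \<rho> n
  proof -
    interpret \<rho>: prob_space \<rho> by fact
    have i1: "integrable \<rho> f" by (rule \<rho>.integrable_const_bound[where B=B]) (use B in auto)
    have i2: "integrable \<rho> (\<kappa> n)" by (rule \<rho>.integrable_const_bound[where B=1]) (use \<kappa>01 in auto)
    have i3: "integrable \<rho> (\<lambda>x. f x * \<kappa> n x)"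
      by (rule \<rho>.integrable_const_bound[where B="B * 1"])
        (use B B0 \<kappa>01 in \<open>auto simp del: mult_1_right simp: abs_mult intro!: mult_mono\<close>)
    have "\<bar>(\<integral>x. f x \<partial>\<rho>) - (\<integral>x. f x * \<kappa> n x \<partial>\<rho>)\<bar> = \<bar>\<integral>x. f x * (1 - \<kappa> n x) \<partial>\<rho>\<bar>"
      using i1 i3 by (simp add: right_diff_distrib)
    also have "\<dots> \<le> (\<integral>x. \<bar>f x * (1 - \<kappa> n x)\<bar> \<partial>\<rho>)" by (rule integral_abs_bound)
    also have "\<dots> \<le> (\<integral>x. B * (1 - \<kappa> n x) \<partial>\<rho>)"
    proof (intro integral_mono integrable_abs)
      show "\<bar>f x * (1 - \<kappa> n x)\<bar> \<le> B * (1 - \<kappa> n x)" for x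
        using B[of x] \<kappa>01(2)[of n x] by (simp add: abs_mult mult_right_mono)
    qed (use i1 i2 i3 in \<open>auto simp: right_diff_distrib\<close>)
    finally show ?thesis using i2 by (simp add: \<rho>.prob_space)
  qed
  show "((\<lambda>s. \<integral>x. f x \<partial>\<mu> s) \<longlongrightarrow> (\<integral>x. f x \<partial>\<nu>)) at_top"
  proof (rule tendstoI)
    fix e :: real assume e: "e > 0"
    \<comment> \<open>Each of the two truncations costs at most \<open>B d \<le> e / 4\<close>,
      leaving \<open>e / 2\<close> for the truncated integrals; \<open>B + 1\<close> avoids dividing
      by zero.\<close>
    define d where "d = e / (4 * (B + 1))"
    have d: "d > 0" using e B0 by (simp add: d_def)
    obtain n where n: "1 - d < (\<integral>x. \<kappa> n x \<partial>\<nu>)"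
      using order_tendstoD(1)[OF \<kappa>lim, of "1 - d"] d by (auto simp: eventually_sequentially)
    have "((\<lambda>s. \<integral>x. \<kappa> n x \<partial>\<mu> s) \<longlongrightarrow> (\<integral>x. \<kappa> n x \<partial>\<nu>)) at_top"
      by (rule vague_convergence_of_char[OF \<mu> \<nu> char \<kappa>c supp])
    then have ev1: "\<forall>\<^sub>F s in at_top. 1 - d < (\<integral>x. \<kappa> n x \<partial>\<mu> s)"
      using n by (rule order_tendstoD)
    have "((\<lambda>s. \<integral>x. f x * \<kappa> n x \<partial>\<mu> s) \<longlongrightarrow> (\<integral>x. f x * \<kappa> n x \<partial>\<nu>)) at_top"
      by (rule vague_convergence_of_char[OF \<mu> \<nu> char, of _ "real n + 1"])
        (auto intro!: continuous_intros cont \<kappa>c simp: supp)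
    then have ev2: "\<forall>\<^sub>F s in at_top. dist (\<integral>x. f x * \<kappa> n x \<partial>\<mu> s) (\<integral>x. f x * \<kappa> n x \<partial>\<nu>) < e / 2"
      using e by (intro tendstoD) auto
    have "B * r \<le> e / 4" if "r < d" for r
    proof -
      have "B * r \<le> B * d" using that B0 by (intro mult_left_mono) auto
      also have "\<dots> \<le> (B + 1) * d" using d by (simp add: algebra_simps)
      also have "\<dots> = e / 4" using B0 by (simp add: d_def divide_simps)
      finally show ?thesis .
    qed
    note small = this
    from ev1 ev2 show "\<forall>\<^sub>F s in at_top. dist (\<integral>x. f x \<partial>\<mu> s) (\<integral>x. f x \<partial>\<nu>) < e"
    proof eventually_elim
      case (elim s)
      have "\<bar>(\<integral>x. f x \<partial>\<mu> s) - (\<integral>x. f x * \<kappa> n x \<partial>\<mu> s)\<bar> \<le> e / 4"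
        using trunc[OF \<mu>, of s n] small[of "1 - (\<integral>x. \<kappa> n x \<partial>\<mu> s)"] elim by linarith
      moreover have "\<bar>(\<integral>x. f x \<partial>\<nu>) - (\<integral>x. f x * \<kappa> n x \<partial>\<nu>)\<bar> \<le> e / 4"
        using trunc[OF \<nu>, of n] small[of "1 - (\<integral>x. \<kappa> n x \<partial>\<nu>)"] n by linarith
      ultimately show ?case using elim(2) e unfolding dist_real_def by linarith
    qed
  qed
qed

subsection \<open>Characteristic functions of linear stochastic differential equations\<close>

text \<open>The increments of \<open>H\<close> telescope, and local errors below
  \<open>c (b - a)\<close>, uniformly in position, add up to at most \<open>c T\<close>. Both the
  pathwise sums and the variance sums are instances. With \<open>Suc n\<close> intervals the mesh is
  defined for every \<open>n\<close>.\<close>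

lemma tendsto_sum_partition:
  fixes H :: "real \<Rightarrow> real" and G :: "real \<Rightarrow> real \<Rightarrow> real" and T :: real
  assumes T: "T > 0"
    and approx: "\<And>e. e > 0 \<Longrightarrow> \<exists>d>0. \<forall>a b. 0 \<le> a \<and> a \<le> b \<and> b \<le> T \<and> b - a < d \<longrightarrow> \<bar>H b - H a - G a b\<bar> \<le> e * (b - a)"
  shows "(\<lambda>n. \<Sum>k<Suc n. G (T * k / Suc n) (T * Suc k / Suc n)) \<longlonglongrightarrow> H T - H 0"
proof (rule LIMSEQ_I)
  fix e :: real assume e: "e > 0"
  \<comment> \<open>The errors then total at most \<open>e / 2\<close>, which gives the strict
    inequality.\<close>
  define c where "c = e / (2 * T)"
  have c: "c > 0" using e T by (simp add: c_def)
  then obtain d where d: "d > 0"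
    "\<And>a b. 0 \<le> a \<Longrightarrow> a \<le> b \<Longrightarrow> b \<le> T \<Longrightarrow> b - a < d \<Longrightarrow> \<bar>H b - H a - G a b\<bar> \<le> c * (b - a)"
    using approx[OF c] by blast
  obtain N where N: "T / d < real N" using reals_Archimedean2 by blast
  have "norm ((\<Sum>k<Suc n. G (T * k / Suc n) (T * Suc k / Suc n)) - (H T - H 0)) < e" if "n \<ge> N" for n
  proof -
    define s where "s k = T * real k / real (Suc n)" for k
    have s0: "s 0 = 0" and sn: "s (Suc n) = T" by (simp_all add: s_def)
    have step: "s (Suc k) - s k = T / real (Suc n)" for k by (simp add: s_def field_simps del: of_nat_Suc) (simp add: algebra_simps)
    have nn: "0 \<le> s k" for k using T by (simp add: s_def)
    have le: "s k \<le> T" if "k \<le> Suc n" for k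
      using that T by (simp add: s_def divide_le_eq del: of_nat_Suc)
    have "T / d < real (Suc n)" using N that by simp
    then have small: "T / real (Suc n) < d" using d(1) by (simp add: divide_less_eq mult.commute del: of_nat_Suc)
    have "\<bar>G (s k) (s (Suc k)) - (H (s (Suc k)) - H (s k))\<bar> \<le> c * (T / real (Suc n))" if "k < Suc n" for k
    proof -
      have "s k \<le> s (Suc k)" using step[of k] divide_pos_pos[OF T, of "real (Suc n)"] by simp
      then show ?thesis
        using d(2)[of "s k" "s (Suc k)"] nn le[of "Suc k"] that small step[of k] by (simp add: abs_minus_commute)
    qed
    then have "(\<Sum>k<Suc n. \<bar>G (s k) (s (Suc k)) - (H (s (Suc k)) - H (s k))\<bar>) \<le> (\<Sum>k<Suc n. c * (T / real (Suc n)))"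
      by (intro sum_mono) auto
    also have "\<dots> = e / 2" using T by (simp add: c_def del: of_nat_Suc)
    also have "\<dots> < e" using e by simp
    finally have "\<bar>\<Sum>k<Suc n. G (s k) (s (Suc k)) - (H (s (Suc k)) - H (s k))\<bar> < e"
      by (rule le_less_trans[OF sum_abs])
    also have "(\<Sum>k<Suc n. G (s k) (s (Suc k)) - (H (s (Suc k)) - H (s k)))
        = (\<Sum>k<Suc n. G (s k) (s (Suc k))) - (H T - H 0)"
      using sum_lessThan_telescope[of "\<lambda>k. H (s k)" "Suc n"]
      by (simp only: sum_subtractf[of "\<lambda>k. G (s k) (s (Suc k))"] s0 sn)
    finally show ?thesis by (simp only: real_norm_def s_def)
  qed
  then show "\<exists>N. \<forall>n\<ge>N. norm ((\<Sum>k<Suc n. G (T * k / Suc n) (T * Suc k / Suc n)) - (H T - H 0)) < e" by blast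
qed

text \<open>The right endpoint is evaluated because the increments in the pathwise sums carry the
  coefficient at their right end. The local error is a mean value estimate for
  \<open>H s - s g b\<close>, whose derivative is \<open>g s - g b\<close>.\<close>

lemma tendsto_riemann_sum:
  fixes H g :: "real \<Rightarrow> real" and T :: real
  assumes T: "T > 0" and H: "\<And>t. (H has_real_derivative g t) (at t)" and g: "continuous_on UNIV g"
  shows "(\<lambda>n. \<Sum>k<Suc n. (T * Suc k / Suc n - T * k / Suc n) * g (T * Suc k / Suc n)) \<longlonglongrightarrow> H T - H 0"
proof (rule tendsto_sum_partition[OF T, where G="\<lambda>a b. (b - a) * g b"])
  fix e :: real assume "e > 0"
  have "uniformly_continuous_on {0..T} g"
    by (rule compact_uniformly_continuous) (use g continuous_on_subset in auto)
  then obtain d where d: "d > 0" "\<And>x y. x \<in> {0..T} \<Longrightarrow> y \<in> {0..T} \<Longrightarrow> dist y x < d \<Longrightarrow> dist (g y) (g x) < e"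
    using \<open>e > 0\<close> unfolding uniformly_continuous_on_def by meson
  have "\<bar>H b - H a - (b - a) * g b\<bar> \<le> e * (b - a)" if "0 \<le> a" "a \<le> b" "b \<le> T" "b - a < d" for a b
  proof -
    have "norm ((H b - b * g b) - (H a - a * g b)) \<le> e * norm (b - a)"
    proof (rule field_differentiable_bound[of "{a..b}" _ "\<lambda>s. g s - g b"])
      fix s assume s: "s \<in> {a..b}"
      show "((\<lambda>s. H s - s * g b) has_real_derivative g s - g b) (at s within {a..b})"
        by (auto intro!: derivative_eq_intros has_field_derivative_at_within[OF H])
      have "dist (g s) (g b) < e" using that s by (intro d) (auto simp: dist_real_def)
      then show "norm (g s - g b) \<le> e" by (simp add: dist_norm)
    qed (use that in auto)
    then show ?thesis using that by (simp add: algebra_simps)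
  qed
  then show "\<exists>d>0. \<forall>a b. 0 \<le> a \<and> a \<le> b \<and> b \<le> T \<and> b - a < d \<longrightarrow> \<bar>H b - H a - (b - a) * g b\<bar> \<le> e * (b - a)"
    using d(1) by blast
qed

text \<open>
  A pathwise integration by parts: with \<open>v\<close> solving the adjoint equation the drift cancels, and
  \<open>d(v \<bullet> X) = v \<bullet> S dW\<close> becomes a limit of Riemann-Stieltjes sums.
\<close>
lemma dual_pairing_sums:
  fixes x w v :: "real \<Rightarrow> 'a::euclidean_space" and C D S :: "'a \<Rightarrow> 'a" and T :: real
  assumes T: "T > 0" and C: "linear C" and D: "linear D" and S: "linear S"
    and adj: "\<And>y z. D y \<bullet> z = y \<bullet> C z"
    and x: "continuous_on {0..} x" and w: "continuous_on {0..} w"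
    and eq: "\<And>t. t \<ge> 0 \<Longrightarrow> x t = x 0 + integral {0..t} (\<lambda>s. C (x s)) + S (w t - w 0)"
    and v: "\<And>t. (v has_vector_derivative - D (v t)) (at t)"
  shows "(\<lambda>n. \<Sum>k<Suc n. v (T * Suc k / Suc n) \<bullet> S (w (T * Suc k / Suc n) - w (T * k / Suc n)))
    \<longlonglongrightarrow> v T \<bullet> x T - v 0 \<bullet> x 0"
proof (rule tendsto_sum_partition[OF T, where H="\<lambda>s. v s \<bullet> x s" and G="\<lambda>a b. v b \<bullet> S (w b - w a)"])
  fix e :: real assume e: "e > 0"
  have bl: "bounded_linear C" "bounded_linear D" "bounded_linear S"
    using C D S by (auto simp: linear_conv_bounded_linear)
  obtain L where L: "L > 0" "\<And>z. norm (S z) \<le> norm z * L"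
    using bounded_linear.pos_bounded[OF bl(3)] by blast
  have vc: "continuous_on {0..T} v"
    by (meson continuous_at_imp_continuous_on has_vector_derivative_continuous v)
  have "compact ((\<lambda>t. D (v t)) ` {0..T})"
    by (intro compact_continuous_image linear_continuous_on_compose[OF vc D]) auto
  then obtain K where K: "\<forall>t\<in>{0..T}. norm (D (v t)) \<le> K"
    by (auto dest!: compact_imp_bounded simp: bounded_iff)
  have "norm (D (v 0)) \<le> K" using K T by auto
  then have K0: "K \<ge> 0" using norm_ge_zero order_trans by blast
  \<comment> \<open>If \<open>w\<close> oscillates by less than \<open>r\<close> on a short
    interval, then the derivative estimated below is at most \<open>K r L \<le> e\<close>; the
    \<open>+ 1\<close> covers \<open>K = 0\<close>.\<close>
  define r where "r = e / (K * L + 1)"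
  have KL: "K * L + 1 > 0" using K0 L by (simp add: add_nonneg_pos)
  then have r: "r > 0" using e by (simp add: r_def)
  have "uniformly_continuous_on {0..T} w"
    by (rule compact_uniformly_continuous) (auto intro: continuous_on_subset[OF w])
  then obtain d where d: "d > 0" "\<And>s t. s \<in> {0..T} \<Longrightarrow> t \<in> {0..T} \<Longrightarrow> dist t s < d \<Longrightarrow> dist (w t) (w s) < r"
    using r unfolding uniformly_continuous_on_def by meson
  have "\<bar>v b \<bullet> x b - v a \<bullet> x a - v b \<bullet> S (w b - w a)\<bar> \<le> e * (b - a)"
    if ab: "0 \<le> a" "a \<le> b" "b \<le> T" "b - a < d" for a b
  proof -
    \<comment> \<open>The path \<open>x\<close> need not be differentiable, but subtracting its
      noise since time \<open>a\<close> leaves a differentiable path with \<open>y a = x a\<close>.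
      The increment of \<open>v \<bullet> y\<close> over the interval is exactly the local error to
      be bounded.\<close>
    define y where "y s = x s - S (w s - w a)" for s
    have ydef2: "y s = (x 0 + S (w a - w 0)) + integral {0..s} (\<lambda>s. C (x s))" if "s \<in> {a..b}" for s
      using eq[of s] that ab by (simp add: y_def linear_diff[OF S])
    have y': "(y has_vector_derivative C (x s)) (at s within {a..b})" if s: "s \<in> {a..b}" for s
    proof -
      have "continuous_on {0..b} (\<lambda>s. C (x s))"
        by (intro linear_continuous_on_compose[OF _ C] continuous_on_subset[OF x]) auto
      then have "((\<lambda>s. integral {0..s} (\<lambda>s. C (x s))) has_vector_derivative C (x s)) (at s within {0..b})"
        by (rule integral_has_vector_derivative) (use s ab in auto)
      then have "((\<lambda>s. integral {0..s} (\<lambda>s. C (x s))) has_vector_derivative C (x s)) (at s within {a..b})"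
        by (rule has_vector_derivative_within_subset) (use ab in auto)
      then have "((\<lambda>s. (x 0 + S (w a - w 0)) + integral {0..s} (\<lambda>s. C (x s))) has_vector_derivative C (x s)) (at s within {a..b})"
        using has_vector_derivative_add[OF has_vector_derivative_const] by fastforce
      then show ?thesis
        by (rule has_vector_derivative_transform[OF s, rotated]) (rule ydef2)
    qed
    have "norm (v b \<bullet> y b - v a \<bullet> y a) \<le> e * norm (b - a)"
    proof (rule field_differentiable_bound[of "{a..b}" _ "\<lambda>s. D (v s) \<bullet> S (w s - w a)"])
      fix s assume s: "s \<in> {a..b}"
      have "((\<lambda>s. v s \<bullet> y s) has_vector_derivative v s \<bullet> C (x s) + (- D (v s)) \<bullet> y s) (at s within {a..b})"
        by (intro bounded_bilinear.has_vector_derivative[OF bounded_bilinear_inner] y' s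
            has_vector_derivative_at_within[OF v])
      \<comment> \<open>By adjointness the drift of \<open>x\<close> cancels except where
        \<open>y\<close> differs from \<open>x\<close>, and that difference is the small noise
        increment.\<close>
      moreover have "v s \<bullet> C (x s) + (- D (v s)) \<bullet> y s = D (v s) \<bullet> S (w s - w a)"
        by (simp add: y_def inner_simps flip: adj)
      ultimately show "((\<lambda>s. v s \<bullet> y s) has_real_derivative D (v s) \<bullet> S (w s - w a)) (at s within {a..b})"
        by (simp add: has_real_derivative_iff_has_vector_derivative)
      have "dist (w s) (w a) < r" using s ab by (intro d) (auto simp: dist_real_def)
      then have "norm (S (w s - w a)) \<le> r * L"
        using L by (intro order_trans[OF L(2)] mult_right_mono) (auto simp: dist_norm)
      then have "norm (D (v s)) * norm (S (w s - w a)) \<le> K * (r * L)"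
        using s ab K K0 by (intro mult_mono) auto
      then have "norm (D (v s) \<bullet> S (w s - w a)) \<le> r * (K * L)"
        using Cauchy_Schwarz_ineq2 by (smt (verit) mult.commute mult.left_commute real_norm_def)
      also have "\<dots> \<le> r * (K * L + 1)" using r by (intro mult_left_mono) auto
      also have "\<dots> = e" using KL by (simp add: r_def)
      finally show "norm (D (v s) \<bullet> S (w s - w a)) \<le> e" .
    qed (use ab in auto)
    then show ?thesis using ab by (simp add: y_def linear_0[OF S] inner_simps algebra_simps)
  qed
  then show "\<exists>d>0. \<forall>a b. 0 \<le> a \<and> a \<le> b \<and> b \<le> T \<and> b - a < d \<longrightarrow>
      \<bar>v b \<bullet> x b - v a \<bullet> x a - v b \<bullet> S (w b - w a)\<bar> \<le> e * (b - a)"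
    using d(1) by blast
qed

section \<open>Characteristic functions of Brownian increments\<close>

lemma (in prob_space) indep_sub_increment_char:
  fixes U :: "'a \<Rightarrow> complex" and \<Delta> :: "'a \<Rightarrow> 'b::euclidean_space"
  assumes sub: "subalgebra M G" and U: "U \<in> borel_measurable G" and bd: "\<And>x. norm (U x) \<le> 1"
    and distr: "distr M borel \<Delta> = isotropic_gaussian h" and h: "h > 0"
    and ind: "indep_set (sets G) (sets (vimage_algebra (space M) \<Delta> borel))"
    and meas: "\<Delta> \<in> borel_measurable M"
  shows "(\<integral>x. U x * iexp (c \<bullet> \<Delta> x) \<partial>M) = (\<integral>x. U x \<partial>M) * complex_of_real (exp (- (h * (norm c)\<^sup>2) / 2))"
proof -
  let ?Y = "\<lambda>x. iexp (c \<bullet> \<Delta> x)"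
  have UM: "U \<in> borel_measurable M" by (rule measurable_from_subalg[OF sub U])
  have YM: "?Y \<in> borel_measurable M" using meas by measurable
  have spG: "space G = space M" using sub by (simp add: subalgebra_def)
  have Yvim: "?Y \<in> borel_measurable (vimage_algebra (space M) \<Delta> borel)"
    using measurable_compose[OF measurable_vimage_algebra1[of \<Delta> "space M" borel], of "\<lambda>z. iexp (c \<bullet> z)" borel]
    by simp
  \<comment> \<open>Independence is assumed for the past and for the increment; the sigma-algebras
    generated by \<open>U\<close> and by \<open>?Y\<close> are contained in these, so it is
    inherited.\<close>
  have "indep_var borel U borel ?Y"
    unfolding indep_var_eq
  proof (intro conjI UM YM)
    have "sigma_sets (space M) {U -` A \<inter> space M |A. A \<in> sets borel} \<subseteq> sets G"
      unfolding spG[symmetric] by (rule sets.sigma_sets_subset) (use U in \<open>auto intro: measurable_sets\<close>)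
    moreover have "sigma_sets (space M) {?Y -` A \<inter> space M |A. A \<in> sets borel}
        \<subseteq> sets (vimage_algebra (space M) \<Delta> borel)"
    proof -
      have "sigma_sets (space (vimage_algebra (space M) \<Delta> borel)) {?Y -` A \<inter> space M |A. A \<in> sets borel}
          \<subseteq> sets (vimage_algebra (space M) \<Delta> borel)"
        using measurable_sets[OF Yvim] by (intro sets.sigma_sets_subset) auto
      then show ?thesis by simp
    qed
    ultimately show "indep_set (sigma_sets (space M) {U -` A \<inter> space M |A. A \<in> sets borel})
        (sigma_sets (space M) {?Y -` A \<inter> space M |A. A \<in> sets borel})"
      using ind unfolding indep_set_def by (elim indep_sets_mono_sets) (auto split: bool.split)
  qed
  moreover have "integrable M U" using UM bd by (intro integrable_const_bound[where B=1]) auto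
  moreover have "integrable M ?Y" using YM by (intro integrable_const_bound[where B=1]) auto
  ultimately have "(\<integral>x. U x * ?Y x \<partial>M) = (\<integral>x. U x \<partial>M) * (\<integral>x. ?Y x \<partial>M)"
    by (rule indep_var_lebesgue_integral)
  also have "(\<integral>x. ?Y x \<partial>M) = (\<integral>z. iexp (c \<bullet> z) \<partial>distr M borel \<Delta>)"
    using meas by (subst integral_distr) auto
  also have "\<dots> = complex_of_real (exp (- (h * (norm c)\<^sup>2) / 2))"
    unfolding distr using h by (rule gaussian_char)
  finally show ?thesis .
qed

text \<open>The last increment is split off: all earlier factors are measurable at time
  \<open>s n\<close> and bounded by 1, so together they play the role of \<open>U\<close> in the
  one-increment lemma. The general \<open>U\<close> also carries the initial value of the
  equation.\<close>

lemma brownian_increments_char: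
  fixes W :: "real \<Rightarrow> 's \<Rightarrow> 'a::euclidean_space" and U :: "'s \<Rightarrow> complex"
  assumes M: "prob_space M" and F: "prob_filtration M F" and W: "brownian_motion M F W"
    and s0: "s 0 \<ge> 0" and s: "\<And>k. s k < s (Suc k)"
    and U: "U \<in> borel_measurable (F (s 0))" and bd: "\<And>x. norm (U x) \<le> 1"
  shows "(\<integral>x. U x * iexp (\<Sum>k<n. c k \<bullet> (W (s (Suc k)) x - W (s k) x)) \<partial>M)
    = (\<integral>x. U x \<partial>M) * complex_of_real (exp (- (\<Sum>k<n. (s (Suc k) - s k) * (norm (c k))\<^sup>2) / 2))"
proof -
  interpret prob_space M by fact
  have smono: "mono s" using s by (simp add: mono_iff_le_Suc less_imp_le)
  have s_nn: "s k \<ge> 0" for k using s0 monoD[OF smono, of 0 k] by simp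
  have sub: "subalgebra M (F t)" for t using F by (simp add: prob_filtration_def)
  have Fmono: "f \<in> borel_measurable (F t)" if "f \<in> borel_measurable (F r)" "r \<le> t"
    for f :: "'s \<Rightarrow> 'c::topological_space" and r t
  proof (rule measurable_from_subalg[OF _ that(1)])
    show "subalgebra (F t) (F r)"
      using F that(2) by (simp add: prob_filtration_def filtration_def subalgebra_def)
  qed
  have WF: "W (s j) \<in> borel_measurable (F (s k))" if "j \<le> k" for j k
  proof (rule Fmono)
    show "W (s j) \<in> borel_measurable (F (s j))"
      using W s_nn[of j] by (simp add: brownian_motion_def adapted_process_def)
    show "s j \<le> s k" using that by (rule monoD[OF smono])
  qed
  show ?thesis
  proof (induction n)
    case (Suc n)
    let ?V = "\<lambda>x. U x * iexp (\<Sum>k<n. c k \<bullet> (W (s (Suc k)) x - W (s k) x))"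
    let ?\<Delta> = "\<lambda>x. W (s (Suc n)) x - W (s n) x"
    have "(\<integral>x. ?V x * iexp (c n \<bullet> ?\<Delta> x) \<partial>M) = (\<integral>x. ?V x \<partial>M) * complex_of_real (exp (- ((s (Suc n) - s n) * (norm (c n))\<^sup>2) / 2))"
    proof (rule indep_sub_increment_char[OF sub])
      have [measurable]: "U \<in> borel_measurable (F (s n))"
        by (rule Fmono[OF U]) (use monoD[OF smono] in auto)
      have [measurable]: "(\<lambda>x. \<Sum>k<n. c k \<bullet> (W (s (Suc k)) x - W (s k) x)) \<in> borel_measurable (F (s n))"
        by (intro borel_measurable_sum borel_measurable_inner borel_measurable_diff WF) auto
      show "?V \<in> borel_measurable (F (s n))" by measurable
      show "norm (?V x) \<le> 1" for x using bd[of x] by (simp add: norm_mult)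
      show "distr M borel ?\<Delta> = isotropic_gaussian (s (Suc n) - s n)"
        "indep_set (sets (F (s n))) (sets (vimage_algebra (space M) ?\<Delta> borel))"
        using W s[of n] s_nn[of n] by (auto simp: brownian_motion_def)
      show "?\<Delta> \<in> borel_measurable M"
        using measurable_from_subalg[OF sub WF[of "Suc n" "Suc n"]] measurable_from_subalg[OF sub WF[of n n]]
        by (intro borel_measurable_diff) auto
    qed (use s in simp)
    moreover have "(\<lambda>x. ?V x * iexp (c n \<bullet> ?\<Delta> x)) = (\<lambda>x. U x * iexp (\<Sum>k<Suc n. c k \<bullet> (W (s (Suc k)) x - W (s k) x)))"
      by (simp add: distrib_left exp_add mult_ac)
    moreover have "exp (- (\<Sum>k<n. (s (Suc k) - s k) * (norm (c k))\<^sup>2) / 2) * exp (- ((s (Suc n) - s n) * (norm (c n))\<^sup>2) / 2)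
        = exp (- (\<Sum>k<Suc n. (s (Suc k) - s k) * (norm (c k))\<^sup>2) / 2)"
      by (simp add: diff_divide_distrib flip: exp_add)
    ultimately show ?case
      unfolding Suc by (simp only: mult.assoc flip: of_real_mult)
  qed simp
qed

lemma inner_transpose_mult:
  fixes C :: "real^'n^'n"
  shows "(transpose C *v y) \<bullet> z = y \<bullet> (C *v z)"
  by (simp add: transpose_matrix_vector dot_lmul_matrix)

text \<open>
  The assumption \<open>balance\<close> says \<open>C + C\<^sup>T = - S S\<^sup>T\<close>, the Lyapunov equation for the covariance \<open>I\<close>; it
  makes \<open>(norm (u t))\<^sup>2\<close> account exactly for the accumulated variance.
\<close>
lemma sde_char:
  fixes W X :: "real \<Rightarrow> 's \<Rightarrow> real^'n" and C S :: "real^'n^'n"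
  assumes M: "prob_space M" and F: "prob_filtration M F" and W: "brownian_motion M F W"
    and X: "sde_solution M F W ((*v) C) S X"
    and S: "transpose S = S" and balance: "\<And>x. 2 * (x \<bullet> (C *v x)) = - (norm (S *v x))\<^sup>2"
    and u: "\<And>t. (u has_vector_derivative transpose C *v u t) (at t)" and T: "T > 0"
  shows "(\<integral>x. iexp (u 0 \<bullet> X T x) \<partial>M)
    = (\<integral>x. iexp (u T \<bullet> X 0 x) \<partial>M) * complex_of_real (exp (- ((norm (u 0))\<^sup>2 - (norm (u T))\<^sup>2) / 2))"
proof -
  interpret prob_space M by fact
  have sub: "subalgebra M (F t)" for t using F by (simp add: prob_filtration_def)
  have XF: "X t \<in> borel_measurable (F t)" and WF: "W t \<in> borel_measurable (F t)" if "t \<ge> 0" for t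
    using X W that by (auto simp: sde_solution_def brownian_motion_def adapted_process_def)
  note XM = measurable_from_subalg[OF sub XF] and WM = measurable_from_subalg[OF sub WF]
  \<comment> \<open>Reversing time gives \<open>v\<close> the adjoint equation with the sign that
    cancels the drift, and the terminal value \<open>v T = u 0\<close>.\<close>
  define v where "v s = u (T - s)" for s
  have v: "(v has_vector_derivative - (transpose C *v v t)) (at t)" for t
  proof -
    have "((\<lambda>s. T - s) has_vector_derivative - 1) (at t)"
      by (auto intro!: derivative_eq_intros)
    from vector_diff_chain_at[OF this u] show ?thesis by (simp add: v_def[abs_def] o_def)
  qed
  define s where "s n k = T * real k / real (Suc n)" for n k
  have s_nn: "s n k \<ge> 0" for n k using T by (simp add: s_def)
  have s_less: "s n k < s n (Suc k)" for n k
    unfolding s_def using T by (intro divide_strict_right_mono mult_strict_left_mono) auto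
  \<comment> \<open>Symmetry of \<open>S\<close> moves it onto \<open>v\<close>, leaving
    deterministic coefficients in front of plain Brownian increments.\<close>
  define \<Sigma> where "\<Sigma> n x = (\<Sum>k<Suc n. (S *v v (s n (Suc k))) \<bullet> (W (s n (Suc k)) x - W (s n k) x))" for n x
  define Z where "Z n x = iexp (v 0 \<bullet> X 0 x) * iexp (\<Sigma> n x)" for n x
  have UF: "(\<lambda>x. iexp (v 0 \<bullet> X 0 x)) \<in> borel_measurable (F 0)"
    by (rule measurable_compose[OF XF]) auto
  have \<Sigma>M: "\<Sigma> n \<in> borel_measurable M" for n
    unfolding \<Sigma>_def[abs_def]
    by (intro borel_measurable_sum borel_measurable_inner borel_measurable_diff WM s_nn borel_measurable_const)
  have ZM: "Z n \<in> borel_measurable M" for n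
    unfolding Z_def[abs_def]
    by (intro borel_measurable_times measurable_from_subalg[OF sub UF] measurable_compose[OF \<Sigma>M]) simp
  \<comment> \<open>The limit holds path by path on the almost sure event where both paths are
    continuous and the equation holds at all times; modulus 1 then allows dominated
    convergence.\<close>
  have Zlim: "AE x in M. (\<lambda>n. Z n x) \<longlonglongrightarrow> iexp (v T \<bullet> X T x)"
  proof -
    have "AE x in M. continuous_on {0..} (\<lambda>t. W t x)" using W by (simp add: brownian_motion_def)
    moreover have "AE x in M. continuous_on {0..} (\<lambda>t. X t x)"
      and "AE x in M. \<forall>t\<ge>0. X t x = X 0 x + integral {0..t} (\<lambda>s. C *v (X s x)) + S *v (W t x - W 0 x)"
      using X by (simp_all add: sde_solution_def)
    ultimately show ?thesis
    proof eventually_elim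
      case (elim x)
      have "(\<lambda>n. \<Sum>k<Suc n. v (T * Suc k / Suc n) \<bullet> (S *v (W (T * Suc k / Suc n) x - W (T * k / Suc n) x)))
          \<longlonglongrightarrow> v T \<bullet> X T x - v 0 \<bullet> X 0 x"
      proof (rule dual_pairing_sums[OF T matrix_vector_mul_linear matrix_vector_mul_linear
            matrix_vector_mul_linear inner_transpose_mult elim(2) elim(1) _ v])
        show "X t x = X 0 x + integral {0..t} (\<lambda>s. C *v (X s x)) + S *v (W t x - W 0 x)" if "t \<ge> 0" for t
          using elim(3) that by blast
      qed
      then have "(\<lambda>n. \<Sigma> n x) \<longlonglongrightarrow> v T \<bullet> X T x - v 0 \<bullet> X 0 x"
        unfolding \<Sigma>_def s_def inner_symmetric_matrix[OF S] .
      then have "(\<lambda>n. iexp (v 0 \<bullet> X 0 x) * iexp (\<Sigma> n x)) \<longlonglongrightarrow>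
          iexp (v 0 \<bullet> X 0 x) * iexp (v T \<bullet> X T x - v 0 \<bullet> X 0 x)"
        by (intro tendsto_intros)
      moreover have "iexp (v 0 \<bullet> X 0 x) * iexp (v T \<bullet> X T x - v 0 \<bullet> X 0 x) = iexp (v T \<bullet> X T x)"
        by (simp add: right_diff_distrib flip: exp_add)
      ultimately show ?case by (simp only: Z_def)
    qed
  qed
  have "(\<lambda>n. \<integral>x. Z n x \<partial>M) \<longlonglongrightarrow> (\<integral>x. iexp (v T \<bullet> X T x) \<partial>M)"
  proof (rule integral_dominated_convergence[where w="\<lambda>_. 1", OF _ ZM _ Zlim])
    show "(\<lambda>x. iexp (v T \<bullet> X T x)) \<in> borel_measurable M"
      using T by (intro measurable_compose[OF XM]) auto
  qed (simp_all add: Z_def norm_mult)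
  moreover have "(\<integral>x. Z n x \<partial>M) = (\<integral>x. iexp (v 0 \<bullet> X 0 x) \<partial>M) *
      complex_of_real (exp (- (\<Sum>k<Suc n. (s n (Suc k) - s n k) * (norm (S *v v (s n (Suc k))))\<^sup>2) / 2))" for n
    unfolding Z_def \<Sigma>_def
  proof (rule brownian_increments_char[OF M F W, where s="s n" and U="\<lambda>x. iexp (v 0 \<bullet> X 0 x)"
        and c="\<lambda>k. S *v v (s n (Suc k))"])
    show "(\<lambda>x. iexp (v 0 \<bullet> X 0 x)) \<in> borel_measurable (F (s n 0))" using UF by (simp add: s_def)
  qed (simp_all add: s_nn s_less)
  ultimately have lim1: "(\<lambda>n. (\<integral>x. iexp (v 0 \<bullet> X 0 x) \<partial>M) *
      complex_of_real (exp (- (\<Sum>k<Suc n. (s n (Suc k) - s n k) * (norm (S *v v (s n (Suc k))))\<^sup>2) / 2)))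
      \<longlonglongrightarrow> (\<integral>x. iexp (v T \<bullet> X T x) \<partial>M)"
    by (simp only:)
  \<comment> \<open>By \<open>balance\<close>, \<open>(norm (S *v v t))\<^sup>2\<close> is the
    derivative of \<open>(norm (v t))\<^sup>2\<close> along the reversed flow, so the variance sums
    telescope in the limit.\<close>
  have "(\<lambda>n. \<Sum>k<Suc n. (s n (Suc k) - s n k) * (norm (S *v v (s n (Suc k))))\<^sup>2)
      \<longlonglongrightarrow> (norm (v T))\<^sup>2 - (norm (v 0))\<^sup>2"
    unfolding s_def
  proof (rule tendsto_riemann_sum[OF T, where g="\<lambda>t. (norm (S *v v t))\<^sup>2" and H="\<lambda>t. (norm (v t))\<^sup>2"])
    fix t
    have "((\<lambda>t. v t \<bullet> v t) has_vector_derivative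
        v t \<bullet> - (transpose C *v v t) + (- (transpose C *v v t)) \<bullet> v t) (at t)"
      by (intro bounded_bilinear.has_vector_derivative[OF bounded_bilinear_inner] v)
    moreover have "v t \<bullet> - (transpose C *v v t) + (- (transpose C *v v t)) \<bullet> v t = (norm (S *v v t))\<^sup>2"
      using balance[of "v t"] inner_transpose_mult[of C "v t" "v t"]
      by (simp only: inner_commute[of "v t" "- (transpose C *v v t)"] inner_minus_left)
    ultimately show "((\<lambda>t. (norm (v t))\<^sup>2) has_real_derivative (norm (S *v v t))\<^sup>2) (at t)"
      by (simp add: has_real_derivative_iff_has_vector_derivative power2_norm_eq_inner)
  next
    have "continuous_on UNIV v"
      by (meson continuous_at_imp_continuous_on has_vector_derivative_continuous v)
    then show "continuous_on UNIV (\<lambda>t. (norm (S *v v t))\<^sup>2)"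
      by (intro continuous_intros linear_continuous_on_compose[OF _ matrix_vector_mul_linear])
  qed
  then have "(\<lambda>n. (\<integral>x. iexp (v 0 \<bullet> X 0 x) \<partial>M) *
      complex_of_real (exp (- (\<Sum>k<Suc n. (s n (Suc k) - s n k) * (norm (S *v v (s n (Suc k))))\<^sup>2) / 2)))
      \<longlonglongrightarrow> (\<integral>x. iexp (v 0 \<bullet> X 0 x) \<partial>M) * complex_of_real (exp (- ((norm (v T))\<^sup>2 - (norm (v 0))\<^sup>2) / 2))"
    by (intro tendsto_mult tendsto_const tendsto_of_real tendsto_exp tendsto_divide tendsto_minus) simp_all
  from LIMSEQ_unique[OF lim1 this] show ?thesis by (simp add: v_def)
qed

lemma linear_sde_converges_weakly:
  fixes W X :: "real \<Rightarrow> 's \<Rightarrow> real^'n" and C S :: "real^'n^'n"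
  assumes M: "prob_space M" and F: "prob_filtration M F" and W: "brownian_motion M F W"
    and X: "sde_solution M F W ((*v) C) S X"
    and S: "transpose S = S" and balance: "\<And>x. 2 * (x \<bullet> (C *v x)) = - (norm (S *v x))\<^sup>2"
    and stable: "\<And>u. (\<And>t. (u has_vector_derivative transpose C *v u t) (at t)) \<Longrightarrow> (u \<longlongrightarrow> 0) at_top"
  shows "converges_weakly (\<lambda>s. distr M borel (X s)) standard_gaussian at_top"
proof -
  interpret prob_space M by fact
  have XM: "X t \<in> borel_measurable M" if "t \<ge> 0" for t
    using X F that measurable_from_subalg[of M "F t" "X t"]
    by (simp add: sde_solution_def adapted_process_def prob_filtration_def)
  \<comment> \<open>Nothing is known about \<open>X\<close> at negative times, not even
    measurability. Clamping the time makes every \<open>\<mu> s\<close> a probability measure and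
    changes nothing for \<open>s \<ge> 0\<close>.\<close>
  define \<mu> where "\<mu> s = distr M borel (X (max s 0))" for s
  have lim_\<mu>: "converges_weakly \<mu> standard_gaussian at_top"
  proof (rule levy_continuity_euclidean)
    show "prob_space (\<mu> s)" for s unfolding \<mu>_def by (rule prob_space_distr) (simp add: XM)
    show "sets (\<mu> s) = sets borel" for s by (simp add: \<mu>_def)
    show "prob_space (standard_gaussian :: (real^'n) measure)" by (rule prob_space_isotropic_gaussian) simp
    fix \<xi> :: "real^'n"
    obtain u where u0: "u 0 = \<xi>" and u: "\<And>t. (u has_vector_derivative transpose C *v u t) (at t)"
      using linear_flow_exists[of "(*v) (transpose C)" \<xi>] by auto
    have lim: "(u \<longlongrightarrow> 0) at_top" using u by (rule stable)
    \<comment> \<open>Here the initial law is forgotten: the integrand has modulus 1 and tends to 1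
      pointwise as \<open>u t\<close> vanishes.\<close>
    have "((\<lambda>t. \<integral>x. iexp (u t \<bullet> X 0 x) \<partial>M) \<longlongrightarrow> (\<integral>x. iexp (0 \<bullet> X 0 x) \<partial>M)) at_top"
    proof (rule integral_dominated_convergence_at_top[where w="\<lambda>_. 1"])
      show "(\<lambda>x. iexp (z \<bullet> X 0 x)) \<in> borel_measurable M" for z
        by (rule measurable_compose[OF XM]) auto
      then show "(\<lambda>x. iexp (z \<bullet> X 0 x)) \<in> borel_measurable M" for z .
      show "AE x in M. ((\<lambda>t. iexp (u t \<bullet> X 0 x)) \<longlongrightarrow> iexp (0 \<bullet> X 0 x)) at_top"
        by (intro AE_I2 tendsto_intros lim)
    qed simp_all
    then have "((\<lambda>t. \<integral>x. iexp (u t \<bullet> X 0 x) \<partial>M) \<longlongrightarrow> 1) at_top"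
      by (simp add: prob_space)
    moreover have "((\<lambda>t. complex_of_real (exp (- ((norm \<xi>)\<^sup>2 - (norm (u t))\<^sup>2) / 2)))
        \<longlongrightarrow> complex_of_real (exp (- ((norm \<xi>)\<^sup>2 - (norm (0 :: real^'n))\<^sup>2) / 2))) at_top"
      by (intro tendsto_intros lim) simp
    ultimately have "((\<lambda>t. (\<integral>x. iexp (u t \<bullet> X 0 x) \<partial>M) * complex_of_real (exp (- ((norm \<xi>)\<^sup>2 - (norm (u t))\<^sup>2) / 2)))
        \<longlongrightarrow> 1 * complex_of_real (exp (- ((norm \<xi>)\<^sup>2 - (norm (0 :: real^'n))\<^sup>2) / 2))) at_top"
      by (rule tendsto_mult)
    moreover have "\<forall>\<^sub>F t in at_top. (\<integral>x. iexp (u t \<bullet> X 0 x) \<partial>M) * complex_of_real (exp (- ((norm \<xi>)\<^sup>2 - (norm (u t))\<^sup>2) / 2))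
        = (\<integral>x. iexp (\<xi> \<bullet> x) \<partial>\<mu> t)"
      using eventually_gt_at_top[of 0]
    proof eventually_elim
      case (elim t)
      have "(\<integral>x. iexp (\<xi> \<bullet> x) \<partial>\<mu> t) = (\<integral>x. iexp (u 0 \<bullet> X t x) \<partial>M)"
        using elim by (simp add: \<mu>_def u0 max_def integral_distr[OF XM])
      then show ?case using sde_char[OF M F W X S balance u elim] by (simp only: u0)
    qed
    ultimately have "((\<lambda>s. \<integral>x. iexp (\<xi> \<bullet> x) \<partial>\<mu> s)
        \<longlongrightarrow> 1 * complex_of_real (exp (- ((norm \<xi>)\<^sup>2 - (norm (0 :: real^'n))\<^sup>2) / 2))) at_top"
      by (rule Lim_transform_eventually)
    then show "((\<lambda>s. \<integral>x. iexp (\<xi> \<bullet> x) \<partial>\<mu> s) \<longlongrightarrow> (\<integral>x. iexp (\<xi> \<bullet> x) \<partial>standard_gaussian)) at_top"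
      by (simp add: gaussian_char)
  qed simp
  show ?thesis
    unfolding converges_weakly_def
  proof (intro allI impI)
    fix f :: "real^'n \<Rightarrow> real"
    assume "continuous_on UNIV f" "bounded (range f)"
    then have "((\<lambda>s. \<integral>x. f x \<partial>\<mu> s) \<longlongrightarrow> (\<integral>x. f x \<partial>standard_gaussian)) at_top"
      using lim_\<mu> by (simp add: converges_weakly_def)
    moreover have "\<forall>\<^sub>F s in at_top. (\<integral>x. f x \<partial>\<mu> s) = (\<integral>x. f x \<partial>distr M borel (X s))"
      using eventually_ge_at_top[of 0] by eventually_elim (simp add: \<mu>_def)
    ultimately show "((\<lambda>s. \<integral>x. f x \<partial>distr M borel (X s)) \<longlongrightarrow> (\<integral>x. f x \<partial>standard_gaussian)) at_top"
      by (rule Lim_transform_eventually)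
  qed
qed

section \<open>The degenerate block system\<close>

theorem corollary3p4:
  fixes A B :: "real^'d^'d"
    and \<omega> Rinv :: "real^('d + 'd)^('d + 'd)"
    and M :: "'s measure"
    and F :: "real \<Rightarrow> 's measure"
    and W X :: "real \<Rightarrow> 's \<Rightarrow> real^('d + 'd)"
  assumes "transpose \<omega> = - \<omega>"
    and "\<omega> = block_matrix 0 A (- A) 0"
    and "Rinv = block_matrix 0 0 0 B"
    and "transpose A = A" and "pos_definite A"
    and "transpose B = B" and "pos_definite B"
    and "prob_space M"
    and "prob_filtration M F"
    and "brownian_motion M F W"
    and "sde_solution M F W
           (\<lambda>x. (1/2) *\<^sub>R (- (Rinv *v x) - 2 *\<^sub>R (\<omega> *v x))) (matrix_sqrt Rinv) X"
  shows "converges_weakly (\<lambda>s. distr M borel (X s)) standard_gaussian at_top"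
proof -
  define S where "S = matrix_sqrt Rinv"
  define C where "C = (- 1/2) *\<^sub>R Rinv - \<omega>"
  have Cx: "C *v x = (1/2) *\<^sub>R (- (Rinv *v x) - 2 *\<^sub>R (\<omega> *v x))" for x
  proof -
    have "C *v x = (- 1/2) *\<^sub>R (Rinv *v x) - \<omega> *v x"
      by (simp only: C_def matrix_vector_mult_diff_rdistrib scaleR_matrix_vector_assoc)
    then show ?thesis by (simp add: scaleR_diff_right)
  qed
  have symA: "(A *v x) \<bullet> y = x \<bullet> (A *v y)" and symB: "(B *v x) \<bullet> y = x \<bullet> (B *v y)" for x y
    using assms(4,6) by (simp_all add: inner_symmetric_matrix)
  have minus: "(- A) *v x = - (A *v x)" for x
    by (simp add: vec_eq_iff matrix_vector_mult_def sum_negf)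
  have R: "vec_left (Rinv *v x) = 0" "vec_right (Rinv *v x) = B *v vec_right x"
    and \<omega>: "vec_left (\<omega> *v x) = A *v vec_right x" "vec_right (\<omega> *v x) = - (A *v vec_left x)" for x
    unfolding assms(2,3) block_matrix_mult by (simp_all add: minus)
  have symR: "transpose Rinv = Rinv"
    by (rule symmetric_matrix_of_inner) (simp add: inner_left_right R symB)
  have psdR: "pos_semidefinite Rinv"
    unfolding pos_semidefinite_def
  proof
    fix x :: "real^('d + 'd)"
    show "0 \<le> x \<bullet> (Rinv *v x)"
      using assms(7) unfolding inner_left_right R pos_definite_def
      by (cases "vec_right x = 0") (auto simp: less_imp_le)
  qed
  note S = matrix_sqrt[OF symR psdR, folded S_def]
  \<comment> \<open>Transposition reverses the rotation and keeps the friction. In block coordinates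
    the dual flow is therefore \<open>q' = A p\<close>, \<open>p' = - A q - (1/2) B p\<close>, the
    damped rotation treated above.\<close>
  have adj: "transpose C *v x = \<omega> *v x - (1/2) *\<^sub>R (Rinv *v x)" for x
  proof -
    have "transpose C = (- 1/2) *\<^sub>R Rinv + \<omega>"
      unfolding vec_eq_iff
    proof (intro allI)
      fix i j
      have "transpose \<omega> $ i $ j = (- \<omega>) $ i $ j" "transpose Rinv $ i $ j = Rinv $ i $ j"
        by (simp_all only: assms(1) symR)
      then show "transpose C $ i $ j = ((- 1/2) *\<^sub>R Rinv + \<omega>) $ i $ j"
        by (simp add: C_def transpose_def)
    qed
    then show ?thesis
      by (simp only: matrix_vector_mult_add_rdistrib flip: scaleR_matrix_vector_assoc) simp
  qed
  show ?thesis
  proof (rule linear_sde_converges_weakly[OF assms(8-10) _ S(1)])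
    show "sde_solution M F W ((*v) C) S X"
      using assms(11) by (simp add: S_def Cx[abs_def])
    show "2 * (x \<bullet> (C *v x)) = - (norm (S *v x))\<^sup>2" for x
    proof -
      have "(norm (S *v x))\<^sup>2 = x \<bullet> (Rinv *v x)"
        by (simp add: power2_norm_eq_inner inner_symmetric_matrix[OF S(1)] matrix_vector_mul_assoc S(2))
      \<comment> \<open>The two off-diagonal contributions cancel by symmetry of \<open>A\<close>,
        so only the friction enters the balance with the noise.\<close>
      moreover have "x \<bullet> (\<omega> *v x) = 0"
        using symA[of "vec_right x" "vec_left x"] by (simp add: inner_left_right \<omega> inner_commute)
      ultimately show ?thesis by (simp add: Cx inner_simps)
    qed
    fix u :: "real \<Rightarrow> real^('d + 'd)"
    assume u: "\<And>t. (u has_vector_derivative transpose C *v u t) (at t)"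
    have bl: "bounded_linear (vec_left :: real^('d + 'd) \<Rightarrow> _)" "bounded_linear (vec_right :: real^('d + 'd) \<Rightarrow> _)"
      using linear_vec_left linear_vec_right by (simp_all add: linear_conv_bounded_linear)
    have "((\<lambda>t. (norm (vec_left (u t)))\<^sup>2 + (norm (vec_right (u t)))\<^sup>2) \<longlongrightarrow> 0) at_top"
    proof (rule damped_rotation_decay[OF symA assms(5,7)])
      fix t
      show "((\<lambda>t. vec_left (u t)) has_vector_derivative A *v vec_right (u t)) (at t)"
        using bounded_linear.has_vector_derivative[OF bl(1) u[of t]]
        unfolding adj by (simp add: linear_diff[OF linear_vec_left] linear_scale[OF linear_vec_left] R \<omega>)
      show "((\<lambda>t. vec_right (u t)) has_vector_derivative - (A *v vec_left (u t)) - (1/2) *\<^sub>R (B *v vec_right (u t))) (at t)"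
        using bounded_linear.has_vector_derivative[OF bl(2) u[of t]]
        unfolding adj by (simp add: linear_diff[OF linear_vec_right] linear_scale[OF linear_vec_right] R \<omega>)
    qed
    then have "((\<lambda>t. (norm (u t))\<^sup>2) \<longlongrightarrow> 0) at_top"
      by (simp add: power2_norm_eq_inner inner_left_right)
    then show "(u \<longlongrightarrow> 0) at_top"
      using tendsto_real_sqrt[of "\<lambda>t. (norm (u t))\<^sup>2" 0 at_top] by (simp add: tendsto_norm_zero_iff)
  qed
qed

end
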